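(* Let $n\ge 2$ and $0\le k\le n-2$. The number of different types of codimension $k$ faces of the associahedron $K_n$ equals $p_{k+1}(n-1)$, the number of partitions of $n-1$ into exactly $k+1$ positive integer parts. More precisely, the types correspond bijectively to such partitions: a codimension $k$ face represented by an $(n+1)$-gon dissected by $k$ non-crossing diagonals into $k+1$ cells with $j_1,\dots,j_{k+1}$ sides corresponds to the partition $n-1=n_1+\cdots+n_{k+1}$ with $n_i=j_i-2$, and this face is the polytope $K_{n_1+1}\times\cdots\times K_{n_{k+1}+1}=K_{j_1-1}\times\cdots\times K_{j_{k+1}-1}$.
   Context: The associahedron $K_n$ is a convex polytope of dimension $n-2$ whose codimension $k$ faces correspond to the ways of placing $k$ pairwise non-crossing diagonals in a convex $(n+1)$-gon (face inclusion corresponds to adding diagonals). $K_2$ is a point, $K_3$ a segment, $K_4$ a pentagon. The $k$ diagonals dissect the $(n+1)$-gon into $k+1$ regions called cells; a face whose dissection has cells with $j_1,\dots,j_{k+1}$ sides is (combinatorially) the product $K_{j_1-1}\times\cdots\times K_{j_{k+1}-1}$. Two faces are of the same type if their corresponding faces are the same polytope. $p_k(n)$ denotes the number of ways to write $n=n_1+\cdots+n_k$ with positive integers $n_i$, disregarding order. *)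

theory Defs
  imports "HOL-Analysis.Analysis" "HOL-Library.Multiset"
begin

text \<open>
  A convex polygon is given by its finite set of vertices, numbered in cyclic order by natural
  numbers; the chord joining vertices \<open>a < b\<close> is the pair \<open>(a, b)\<close>. A chord is a side iff no
  vertex lies strictly on one of its two sides. The cells of a dissection are again polygons on
  subsets of the vertices.
\<close>

definition polygon_sides :: "nat set \<Rightarrow> (nat \<times> nat) set" where
  "polygon_sides S =
     {(a, b). a \<in> S \<and> b \<in> S \<and> a < b \<and> (S \<inter> {a<..<b} = {} \<or> S \<subseteq> {a..b})}"

definition polygon_diagonals :: "nat set \<Rightarrow> (nat \<times> nat) set" where
  "polygon_diagonals S = {(a, b). a \<in> S \<and> b \<in> S \<and> a < b} - polygon_sides S"

definition crossing :: "nat \<times> nat \<Rightarrow> nat \<times> nat \<Rightarrow> bool" where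
  "crossing d e \<longleftrightarrow>
     (fst d < fst e \<and> fst e < snd d \<and> snd d < snd e) \<or>
     (fst e < fst d \<and> fst d < snd e \<and> snd e < snd d)"

definition dissections :: "nat set \<Rightarrow> (nat \<times> nat) set set" where
  "dissections S =
     {D. D \<subseteq> polygon_diagonals S \<and> (\<forall>d\<in>D. \<forall>e\<in>D. \<not> crossing d e)}"

text \<open>
  A cell is identified with its set of vertices: it is bounded by sides of the polygon and
  diagonals of the dissection, and is not cut by any further diagonal of the dissection.
\<close>

definition cells :: "nat set \<Rightarrow> (nat \<times> nat) set \<Rightarrow> nat set set" where
  "cells S D =
     {C. C \<subseteq> S \<and> 3 \<le> card C \<and> polygon_sides C \<subseteq> polygon_sides S \<union> D \<and>
         polygon_diagonals C \<inter> D = {}}"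

definition num_sides :: "nat set \<Rightarrow> nat" where
  "num_sides C = card (polygon_sides C)"

text \<open>
  The associahedron is a convex polytope only determined up to combinatorial equivalence, so it is
  a property of a polytope. The map \<open>\<Phi>\<close> sends a dissection of the \<open>(n+1)\<close>-gon to the (nonempty)
  face that it represents.
\<close>

definition represents_faces ::
    "nat \<Rightarrow> 'a::euclidean_space set \<Rightarrow> ((nat \<times> nat) set \<Rightarrow> 'a set) \<Rightarrow> bool" where
  "represents_faces n P \<Phi> \<longleftrightarrow>
     bij_betw \<Phi> (dissections {0..n}) {F. F face_of P \<and> F \<noteq> {}} \<and>
     (\<forall>D\<in>dissections {0..n}. \<forall>E\<in>dissections {0..n}. \<Phi> D \<subseteq> \<Phi> E \<longleftrightarrow> E \<subseteq> D) \<and>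
     (\<forall>D\<in>dissections {0..n}. aff_dim (\<Phi> D) = aff_dim P - int (card D))"

definition associahedron :: "nat \<Rightarrow> 'a::euclidean_space set \<Rightarrow> bool" where
  "associahedron n P \<longleftrightarrow>
     polytope P \<and> aff_dim P = int n - 2 \<and> (\<exists>\<Phi>. represents_faces n P \<Phi>)"

definition codim_faces :: "nat \<Rightarrow> 'a::euclidean_space set \<Rightarrow> 'a set set" where
  "codim_faces k P = {F. F face_of P \<and> F \<noteq> {} \<and> aff_dim F = aff_dim P - int k}"

text \<open>Combinatorial equivalence: isomorphic face lattices.\<close>

definition comb_equiv :: "'a::euclidean_space set \<Rightarrow> 'b::euclidean_space set \<Rightarrow> bool" where
  "comb_equiv P Q \<longleftrightarrow>
     (\<exists>f. bij_betw f {F. F face_of P} {G. G face_of Q} \<and>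
          (\<forall>F F'. F face_of P \<longrightarrow> F' face_of P \<longrightarrow> (f F \<subseteq> f F' \<longleftrightarrow> F \<subseteq> F')))"

definition same_type :: "nat \<Rightarrow> 'a::euclidean_space set \<Rightarrow> ('a set \<times> 'a set) set" where
  "same_type k P =
     {(F, G). F \<in> codim_faces k P \<and> G \<in> codim_faces k P \<and> comb_equiv F G}"

definition face_types :: "nat \<Rightarrow> 'a::euclidean_space set \<Rightarrow> 'a set set set" where
  "face_types k P = codim_faces k P // same_type k P"

definition product_polytope :: "('r::finite \<Rightarrow> 'a::euclidean_space set) \<Rightarrow> ('a ^ 'r) set" where
  "product_polytope Q = {x. \<forall>i. x $ i \<in> Q i}"

definition partitions_into :: "nat \<Rightarrow> nat \<Rightarrow> nat multiset set" where
  "partitions_into k n = {N. size N = k \<and> (\<forall>x\<in>#N. 0 < x) \<and> sum_mset N = n}"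

definition num_partitions_into :: "nat \<Rightarrow> nat \<Rightarrow> nat" where
  "num_partitions_into k n = card (partitions_into k n)"

definition cell_partition :: "nat set \<Rightarrow> (nat \<times> nat) set \<Rightarrow> nat multiset" where
  "cell_partition S D = image_mset (\<lambda>C. num_sides C - 2) (mset_set (cells S D))"

end

theory Submission
  imports Defs
begin

text \<open>
  The faces of \<open>\<Phi> D\<close> correspond to the dissections containing \<open>D\<close>, that is, to the pairwise
  non-crossing sets of diagonals that can be added to \<open>D\<close>. So the face lattice of \<open>\<Phi> D\<close> is determined
  by the crossing graph on these diagonals and, conversely, determines it: the facets are the
  vertices, and two of them meet iff the diagonals do not cross. Every diagonal that can be added
  is a diagonal of exactly one cell, and diagonals of different cells do not cross, so the crossing
  graph is the disjoint union of the crossing graphs of the cells. This gives the product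
  decomposition, as the faces of a product are the products of faces. Moreover, two diagonals of the
  same cell are equal, cross, or have a common crosser. Hence the graph determines the number of
  diagonals of every cell with at least four sides, and thus the number of its sides; the triangles
  are the remaining cells, and there are \<open>k + 1\<close> cells in total.
\<close>

section \<open>Cells of a dissection\<close>

text \<open>Cells are defined by a condition on their boundary, not by a construction, so neither
  their number nor the way they fit together is evident. Everything about them is obtained by
  cutting along one diagonal of the dissection: the cells, the diagonals that can still be added,
  and the quantity \<open>card S - 2\<close> all split between the two pieces. Since polygons may
  have any finite vertex set while an associahedron refers to \<open>{0..m}\<close>, each cell is
  compared with its standard copy by an increasing relabelling. To read off the partition from the
  graph, multiplicities are obtained by counting diagonals rather than cells: if r cells have d
  diagonals each, they account for r * d vertices of the graph. Dividing by d requires d > 0, and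
  identifying the cells by d requires that d grow strictly with the number of sides.\<close>

lemma mem_polygon_diagonals_iff:
  "(a, b) \<in> polygon_diagonals S \<longleftrightarrow>
     a \<in> S \<and> b \<in> S \<and> a < b \<and> (\<exists>x\<in>S. a < x \<and> x < b) \<and> (\<exists>y\<in>S. y < a \<or> b < y)"
  unfolding polygon_diagonals_def polygon_sides_def by (fastforce simp: not_le)

lemma mem_polygon_sides_iff:
  "(a, b) \<in> polygon_sides S \<longleftrightarrow>
     a \<in> S \<and> b \<in> S \<and> a < b \<and> ((\<forall>x\<in>S. x \<le> a \<or> b \<le> x) \<or> (\<forall>y\<in>S. a \<le> y \<and> y \<le> b))"
  unfolding polygon_sides_def by (fastforce simp: not_le not_less disjoint_iff)

lemma polygon_diagonals_mono: "C \<subseteq> S \<Longrightarrow> polygon_diagonals C \<subseteq> polygon_diagonals S"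
  by (rule subrelI) (fastforce simp: mem_polygon_diagonals_iff)

lemma finite_polygon_diagonals: "finite S \<Longrightarrow> finite (polygon_diagonals S)"
  by (rule finite_subset[of _ "S \<times> S"]) (auto simp: mem_polygon_diagonals_iff)

lemma crossing_irrefl: "\<not> crossing d d"
  by (auto simp: crossing_def)

lemma crossing_sym: "crossing d e \<longleftrightarrow> crossing e d"
  by (auto simp: crossing_def)

lemma side_not_crossing:
  assumes "(p, q) \<in> polygon_sides S" "a \<in> S" "b \<in> S"
  shows "\<not> crossing (p, q) (a, b)"
  using assms by (fastforce simp: mem_polygon_sides_iff crossing_def)

lemma dissectionsD:
  assumes "D \<in> dissections S"
  shows "D \<subseteq> polygon_diagonals S" "d \<in> D \<Longrightarrow> e \<in> D \<Longrightarrow> \<not> crossing d e"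
  using assms by (auto simp: dissections_def)

text \<open>Here \<open>x\<close> need not be a vertex. It marks a cut between \<open>x\<close> and
  \<open>x + 1\<close>, and the nearest vertices on the two sides of this cut are joined by a
  side.\<close>

lemma consecutive_side:
  fixes C :: "nat set"
  assumes "finite C" "u \<in> C" "v \<in> C" "u \<le> x" "x < v"
  obtains p q where "(p, q) \<in> polygon_sides C" "u \<le> p" "p \<le> x" "x < q" "q \<le> v"
    "\<forall>y\<in>C. y \<le> p \<or> q \<le> y"
proof -
  define p where "p = Max (C \<inter> {..x})"
  define q where "q = Min (C \<inter> {x<..})"
  have "C \<inter> {..x} \<noteq> {}" "C \<inter> {x<..} \<noteq> {}"
    using assms by auto
  then have p: "p \<in> C \<inter> {..x}" and q: "q \<in> C \<inter> {x<..}"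
    unfolding p_def q_def using assms(1) by (metis Max_in Min_in finite_Int)+
  have pm: "y \<in> C \<Longrightarrow> y \<le> x \<Longrightarrow> y \<le> p" for y
    unfolding p_def using assms by auto
  have qm: "y \<in> C \<Longrightarrow> x < y \<Longrightarrow> q \<le> y" for y
    unfolding q_def using assms by auto
  have gap: "\<forall>y\<in>C. y \<le> p \<or> q \<le> y"
    using pm qm by (meson not_le)
  then have "(p, q) \<in> polygon_sides C"
    using p q by (auto simp: mem_polygon_sides_iff)
  then show thesis
    using that[of p q] p q pm[of u] qm[of v] assms gap by auto
qed

text \<open>This is the side that closes the polygon, from the least vertex to the greatest; it
  complements the sides between neighbours in the numbering.\<close>

lemma extremal_side:
  fixes C :: "nat set"
  assumes "finite C" "u \<in> C" "v \<in> C" "u < v"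
  obtains p q where "(p, q) \<in> polygon_sides C" "p \<le> u" "v \<le> q" "C \<subseteq> {p..q}"
proof -
  have "C \<noteq> {}" using assms by auto
  then have "Min C \<in> C" "Max C \<in> C" "C \<subseteq> {Min C..Max C}" "Min C \<le> u" "v \<le> Max C"
    using assms by auto
  then show thesis
    using that[of "Min C" "Max C"] assms(4) unfolding mem_polygon_sides_iff
    by (auto simp: subset_iff)
qed

text \<open>If \<open>C\<close> misses a vertex \<open>x\<close>, some side of \<open>C\<close>
  passes \<open>x\<close> by: the one spanning \<open>x\<close>, or the closing one if
  \<open>x\<close> is outside the range of \<open>C\<close>. As a side of \<open>S\<close> it has
  all vertices on one side, and \<open>x\<close> forces this to be the side without further vertices
  of \<open>C\<close>. So \<open>C\<close> has at most two vertices.\<close>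

lemma cells_empty:
  assumes "finite S" "3 \<le> card S"
  shows "cells S {} = {S}"
proof
  show "{S} \<subseteq> cells S {}"
    using assms by (auto simp: cells_def)
next
  have "C = S" if C: "C \<subseteq> S" "3 \<le> card C" and sides: "polygon_sides C \<subseteq> polygon_sides S" for C
  proof (rule ccontr)
    assume "C \<noteq> S"
    then obtain x where x: "x \<in> S" "x \<notin> C" using C by blast
    have finC: "finite C" using assms C finite_subset by blast
    have big: "\<not> C \<subseteq> {p, q}" for p q
    proof
      assume "C \<subseteq> {p, q}"
      then have "card C \<le> card {p, q}" by (intro card_mono) auto
      also have "\<dots> \<le> 2" by (simp add: card_insert_if)
      finally show False using C by simp
    qed
    show False
    proof (cases "(\<exists>u\<in>C. u \<le> x) \<and> (\<exists>v\<in>C. x < v)")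
      case True
      then obtain p q where pq: "(p, q) \<in> polygon_sides C" "p \<le> x" "x < q"
        "\<forall>y\<in>C. y \<le> p \<or> q \<le> y"
        using consecutive_side[OF finC] by metis
      have "p \<noteq> x" using pq x by (auto simp: mem_polygon_sides_iff)
      with pq x sides have "S \<subseteq> {p..q}"
        by (fastforce simp: mem_polygon_sides_iff)
      then have "C \<subseteq> {p, q}" using pq C by fastforce
      with big show False by blast
    next
      case False
      obtain u v where uv: "u \<in> C" "v \<in> C" "u < v"
        using big by (metis insertCI not_less_iff_gr_or_eq subsetI all_not_in_conv singletonD)
      obtain p q where pq: "(p, q) \<in> polygon_sides C" "C \<subseteq> {p..q}"
        using extremal_side[OF finC uv] by metis
      have "p \<in> C" "q \<in> C" using pq by (auto simp: mem_polygon_sides_iff)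
      with False have "x < p \<or> q \<le> x" by (auto simp: not_le not_less)
      with x \<open>q \<in> C\<close> have "\<not> S \<subseteq> {p..q}" by force
      with pq sides have "\<forall>y\<in>S. y \<le> p \<or> q \<le> y"
        by (fastforce simp: mem_polygon_sides_iff)
      then have "C \<subseteq> {p, q}" using pq C by fastforce
      with big show False by blast
    qed
  qed
  then show "cells S {} \<subseteq> {S}"
    by (auto simp: cells_def)
qed

text \<open>If a cell had vertices strictly on both sides of \<open>(a, b)\<close>, its boundary could only pass
  from one side to the other through \<open>a\<close> and \<open>b\<close>, making \<open>(a, b)\<close> a diagonal of the cell.\<close>

lemma cell_one_sided:
  assumes "finite S" and D: "D \<in> dissections S" and ab: "(a, b) \<in> D" and C: "C \<in> cells S D"
  shows "C \<subseteq> {a..b} \<or> C \<subseteq> - {a<..<b}"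
proof (rule ccontr)
  assume "\<not> ?thesis"
  then obtain x y where x: "x \<in> C" "a < x" "x < b" and y: "y \<in> C" "y < a \<or> b < y"
    by (auto simp: subset_iff not_le)
  have finC: "finite C"
    using assms finite_subset by (auto simp: cells_def)
  have abS: "a \<in> S" "b \<in> S" "a < b"
    using dissectionsD(1)[OF D] ab by (auto simp: mem_polygon_diagonals_iff)
  \<comment> \<open>The boundary of \<open>C\<close> consists of sides of \<open>S\<close> and of
    diagonals in \<open>D\<close>; neither can cross \<open>(a, b)\<close>.\<close>
  have nocross: "\<not> crossing (p, q) (a, b)" if "(p, q) \<in> polygon_sides C" for p q
    using that C side_not_crossing[of p q S a b] abS dissectionsD(2)[OF D _ ab]
    by (auto simp: cells_def)
  have "a \<in> C"
  proof (cases "\<exists>u\<in>C. u \<le> a")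
    case True
    then obtain u where "u \<in> C" "u \<le> a" by blast
    then obtain p q where "(p, q) \<in> polygon_sides C" "p \<le> a" "a < q" "q \<le> x"
      using consecutive_side[OF finC _ x(1), of u a] x by metis
    with nocross[of p q] x show ?thesis
      by (cases "p = a") (auto simp: crossing_def mem_polygon_sides_iff)
  next
    case False
    \<comment> \<open>With all of \<open>C\<close> above \<open>a\<close>, the closing side would
      run from strictly between \<open>a\<close> and \<open>b\<close> to beyond \<open>b\<close>, a
      crossing.\<close>
    with y have "b < y" by (auto simp: not_le)
    with x obtain p q where "(p, q) \<in> polygon_sides C" "p \<le> x" "y \<le> q"
      using extremal_side[OF finC x(1) y(1)] by (metis less_trans)
    with nocross[of p q] x False \<open>b < y\<close> show ?thesis
      by (auto simp: crossing_def mem_polygon_sides_iff not_le)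
  qed
  moreover have "b \<in> C"
  proof (cases "\<exists>v\<in>C. b \<le> v")
    case True
    then obtain v where v: "v \<in> C" "b \<le> v" by blast
    \<comment> \<open>The cut is placed just below \<open>b\<close>, because the side sought has to
      satisfy p < b \<le> q.\<close>
    moreover have "x \<le> b - 1" "b - 1 < v" using x v by auto
    ultimately obtain p q where "(p, q) \<in> polygon_sides C" "x \<le> p" "p \<le> b - 1" "b - 1 < q"
      using consecutive_side[OF finC x(1), of v "b - 1"] by metis
    with nocross[of p q] x show ?thesis
      by (cases "q = b") (auto simp: crossing_def mem_polygon_sides_iff)
  next
    case False
    with y have "y < a" by (auto simp: not_le)
    with x obtain p q where "(p, q) \<in> polygon_sides C" "p \<le> y" "x \<le> q"
      using extremal_side[OF finC y(1) x(1)] by (metis less_trans)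
    with nocross[of p q] x False \<open>y < a\<close> show ?thesis
      by (auto simp: crossing_def mem_polygon_sides_iff not_le)
  qed
  ultimately have "(a, b) \<in> polygon_diagonals C"
    using x y abS by (auto simp: mem_polygon_diagonals_iff)
  with C ab show False by (auto simp: cells_def)
qed

definition free_diagonals :: "nat set \<Rightarrow> (nat \<times> nat) set \<Rightarrow> (nat \<times> nat) set" where
  "free_diagonals S D = {d \<in> polygon_diagonals S. d \<notin> D \<and> (\<forall>e\<in>D. \<not> crossing d e)}"

section \<open>Cutting a dissected polygon along one of its diagonals\<close>

context
  fixes S S1 S2 :: "nat set" and D D1 D2 :: "(nat \<times> nat) set" and a b :: nat
  assumes finS: "finite S" and D: "D \<in> dissections S" and ab: "(a, b) \<in> D"
  defines "S1 \<equiv> S \<inter> {a..b}" and "S2 \<equiv> S - {a<..<b}"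
    and "D1 \<equiv> D \<inter> polygon_diagonals (S \<inter> {a..b})"
    and "D2 \<equiv> D \<inter> polygon_diagonals (S - {a<..<b})"
begin

private lemma abS: "a \<in> S" "b \<in> S" "a < b" "\<exists>x\<in>S. a < x \<and> x < b" "\<exists>y\<in>S. y < a \<or> b < y"
  using dissectionsD(1)[OF D] ab by (auto simp: mem_polygon_diagonals_iff)

lemma split_finite: "finite S1" "finite S2"
  using finS by (auto simp: S1_def S2_def)

text \<open>The endpoints \<open>a\<close> and \<open>b\<close> belong to both pieces, so the number
  of vertices minus 2 is additive under a cut. This is the origin of the parts j - 2 of the
  partition.\<close>

lemma split_card: "card S1 + card S2 = card S + 2" "3 \<le> card S1" "3 \<le> card S2"
proof -
  have "S1 \<union> S2 = S" "S1 \<inter> S2 = {a, b}"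
    using abS by (auto simp: S1_def S2_def)
  then show "card S1 + card S2 = card S + 2"
    using card_Un_Int[OF split_finite] abS by simp
  obtain x y where "x \<in> S" "a < x" "x < b" "y \<in> S" "y < a \<or> b < y"
    using abS by blast
  then have sub: "{a, x, b} \<subseteq> S1" "{a, y, b} \<subseteq> S2" and "card {a, x, b} = 3" "card {a, y, b} = 3"
    using abS by (auto simp: S1_def S2_def card_insert_if)
  then show "3 \<le> card S1" "3 \<le> card S2"
    using card_mono[OF split_finite(1) sub(1)] card_mono[OF split_finite(2) sub(2)] by simp_all
qed

lemma split_not_crossing:
  "d \<in> polygon_diagonals S1 \<Longrightarrow> e \<in> polygon_diagonals S2 \<Longrightarrow> \<not> crossing d e \<and> \<not> crossing e d"
  by (cases d; cases e) (auto simp: S1_def S2_def mem_polygon_diagonals_iff crossing_def)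

lemma split_diagonals_disjoint: "polygon_diagonals S1 \<inter> polygon_diagonals S2 = {}"
  by (auto simp: S1_def S2_def mem_polygon_diagonals_iff)

text \<open>A chord that avoids crossing \<open>(a, b)\<close> has both ends in one piece. To be a
  diagonal there it needs vertices of that piece on both sides; where the original witness was cut
  off, \<open>a\<close> or \<open>b\<close> takes its place.\<close>

lemma split_diagonals:
  "{d \<in> polygon_diagonals S. d \<noteq> (a, b) \<and> \<not> crossing d (a, b)} =
     polygon_diagonals S1 \<union> polygon_diagonals S2"
proof (intro set_eqI iffI)
  fix d assume "d \<in> {d \<in> polygon_diagonals S. d \<noteq> (a, b) \<and> \<not> crossing d (a, b)}"
  moreover obtain p q where d: "d = (p, q)" by (cases d)
  ultimately have pq: "p \<in> S" "q \<in> S" "p < q" "(p, q) \<noteq> (a, b)" "\<not> crossing (p, q) (a, b)"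
    and x: "\<exists>x\<in>S. p < x \<and> x < q" and y: "\<exists>y\<in>S. y < p \<or> q < y"
    by (auto simp: mem_polygon_diagonals_iff)
  show "d \<in> polygon_diagonals S1 \<union> polygon_diagonals S2"
  proof (cases "a \<le> p \<and> q \<le> b")
    case True
    have "(p, q) \<in> polygon_diagonals S1"
      unfolding mem_polygon_diagonals_iff S1_def
    proof (intro conjI)
      have "a \<in> S \<inter> {a..b}" "b \<in> S \<inter> {a..b}" "a < p \<or> q < b"
        using pq True abS by auto
      then show "\<exists>y\<in>S \<inter> {a..b}. y < p \<or> q < y" by blast
    qed (use pq x True in auto)
    with d show ?thesis by simp
  next
    case False
    with pq abS have out: "p \<notin> {a<..<b}" "q \<notin> {a<..<b}"
      by (auto simp: crossing_def)
    \<comment> \<open>If \<open>(p, q)\<close> encloses \<open>(a, b)\<close>, the vertices between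
      may all have been cut off, but one of \<open>a\<close>, \<open>b\<close> is strictly inside
      since the chords differ. Otherwise the two intervals are disjoint up to endpoints and the old
      witness survives.\<close>
    have "\<exists>x\<in>S2. p < x \<and> x < q"
    proof (cases "p \<le> a \<and> b \<le> q")
      case True
      with pq have "p < a \<or> b < q" by auto
      with True abS show ?thesis by (auto simp: S2_def intro: bexI[of _ a] bexI[of _ b])
    next
      case False
      with out x \<open>\<not> (a \<le> p \<and> q \<le> b)\<close> pq show ?thesis by (fastforce simp: S2_def)
    qed
    moreover have "\<exists>y\<in>S2. y < p \<or> q < y"
    proof (cases "p \<le> a \<and> b \<le> q")
      case True
      with y show ?thesis by (fastforce simp: S2_def)
    next
      case False
      with out pq abS \<open>\<not> (a \<le> p \<and> q \<le> b)\<close> have "b \<le> p \<or> q \<le> a" by auto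
      with abS have "a < p \<or> q < b" by auto
      with abS show ?thesis by (auto simp: S2_def intro: bexI[of _ a] bexI[of _ b])
    qed
    ultimately have "(p, q) \<in> polygon_diagonals S2"
      using pq out by (auto simp: mem_polygon_diagonals_iff S2_def)
    with d show ?thesis by simp
  qed
next
  fix d assume "d \<in> polygon_diagonals S1 \<union> polygon_diagonals S2"
  then show "d \<in> {d \<in> polygon_diagonals S. d \<noteq> (a, b) \<and> \<not> crossing d (a, b)}"
    by (cases d) (auto simp: mem_polygon_diagonals_iff S1_def S2_def crossing_def)
qed

lemma split_dissection: "D = insert (a, b) (D1 \<union> D2)" "(a, b) \<notin> D1 \<union> D2" "D1 \<inter> D2 = {}"
proof -
  have "D \<subseteq> insert (a, b) (polygon_diagonals S1 \<union> polygon_diagonals S2)"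
    unfolding split_diagonals[symmetric] using dissectionsD[OF D] ab by auto
  then show "D = insert (a, b) (D1 \<union> D2)"
    using ab by (auto simp: D1_def D2_def S1_def S2_def)
  show "(a, b) \<notin> D1 \<union> D2" "D1 \<inter> D2 = {}"
    using split_diagonals split_diagonals_disjoint by (auto simp: D1_def D2_def S1_def S2_def)
qed

lemma split_dissections: "D1 \<in> dissections S1" "D2 \<in> dissections S2"
  using dissectionsD[OF D] by (auto simp: dissections_def D1_def D2_def S1_def S2_def)

text \<open>Diagonals of different pieces never cross, so \<open>D2\<close> puts no restriction on
  the diagonals of \<open>S1\<close>, nor \<open>D1\<close> on those of \<open>S2\<close>.\<close>

lemma split_free_diagonals: "free_diagonals S D = free_diagonals S1 D1 \<union> free_diagonals S2 D2"
proof -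
  have "free_diagonals S D =
    {d \<in> polygon_diagonals S1 \<union> polygon_diagonals S2. d \<notin> D1 \<union> D2 \<and> (\<forall>e\<in>D1 \<union> D2. \<not> crossing d e)}"
    unfolding split_diagonals[symmetric] free_diagonals_def
    by (subst (1 2) split_dissection(1)) auto
  also have "\<dots> = free_diagonals S1 D1 \<union> free_diagonals S2 D2"
    using split_not_crossing split_diagonals_disjoint
    unfolding free_diagonals_def D1_def D2_def S1_def S2_def by blast
  finally show ?thesis .
qed

lemma split_sides: "polygon_sides S1 \<subseteq> insert (a, b) (polygon_sides S)"
  "polygon_sides S2 \<subseteq> insert (a, b) (polygon_sides S)"
proof -
  have ends: "a \<in> S1" "b \<in> S1" "a \<in> S2" "b \<in> S2"
    using abS by (auto simp: S1_def S2_def)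
  show "polygon_sides S1 \<subseteq> insert (a, b) (polygon_sides S)"
  proof (rule subrelI)
    fix p q assume pq: "(p, q) \<in> polygon_sides S1"
    then have "p \<in> S" "q \<in> S" "p < q" "a \<le> p" "q \<le> b"
      by (auto simp: mem_polygon_sides_iff S1_def)
    moreover from pq consider "\<forall>x\<in>S1. x \<le> p \<or> q \<le> x" | "\<forall>x\<in>S1. p \<le> x \<and> x \<le> q"
      by (auto simp: mem_polygon_sides_iff)
    then have "(p, q) = (a, b) \<or> (\<forall>x\<in>S. x \<le> p \<or> q \<le> x)"
    proof cases
      case 1
      then show ?thesis using \<open>a \<le> p\<close> \<open>q \<le> b\<close> by (fastforce simp: S1_def)
    next
      case 2
      then show ?thesis using \<open>a \<le> p\<close> \<open>q \<le> b\<close> ends by force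
    qed
    ultimately show "(p, q) \<in> insert (a, b) (polygon_sides S)"
      by (auto simp: mem_polygon_sides_iff)
  qed
  show "polygon_sides S2 \<subseteq> insert (a, b) (polygon_sides S)"
  proof (rule subrelI)
    fix p q assume pq: "(p, q) \<in> polygon_sides S2"
    then have *: "p \<in> S" "q \<in> S" "p < q" "p \<le> a \<or> b \<le> p" "q \<le> a \<or> b \<le> q"
      by (auto simp: mem_polygon_sides_iff S2_def)
    from pq consider "\<forall>x\<in>S2. x \<le> p \<or> q \<le> x" | "\<forall>x\<in>S2. p \<le> x \<and> x \<le> q"
      by (auto simp: mem_polygon_sides_iff)
    then have "(p, q) = (a, b) \<or> (\<forall>x\<in>S. x \<le> p \<or> q \<le> x) \<or> (\<forall>x\<in>S. p \<le> x \<and> x \<le> q)"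
    proof cases
      case 1
      show ?thesis
      proof (cases "p \<le> a \<and> b \<le> q")
        case True
        with 1 ends abS(3) show ?thesis by force
      next
        case False
        have "x \<le> p \<or> q \<le> x" if "x \<in> S" for x
          using that 1 * False by (cases "x \<in> S2") (auto simp: S2_def)
        then show ?thesis by blast
      qed
    next
      case 2
      then have "p \<le> a" "b \<le> q" using ends by auto
      have "p \<le> x \<and> x \<le> q" if "x \<in> S" for x
        using that 2 \<open>p \<le> a\<close> \<open>b \<le> q\<close> by (cases "x \<in> S2") (auto simp: S2_def)
      then show ?thesis by blast
    qed
    with * show "(p, q) \<in> insert (a, b) (polygon_sides S)"
      by (auto simp: mem_polygon_sides_iff)
  qed
qed

text \<open>By \<open>cell_one_sided\<close> a cell lies in one piece. Being a cell means the same
  in the piece and in \<open>S\<close>: the only new side of the piece is \<open>(a, b)\<close>,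
  which belongs to \<open>D\<close>, and the diagonals of a cell inside the piece are diagonals of
  the piece.\<close>

lemma split_cells: "cells S D = cells S1 D1 \<union> cells S2 D2"
proof -
  have down: "C \<in> cells T (D \<inter> polygon_diagonals T)"
    if C: "C \<in> cells S D" and T: "C \<subseteq> T" "T \<subseteq> S" for C T
  proof -
    have "(p, q) \<in> polygon_sides T \<union> (D \<inter> polygon_diagonals T)" if "(p, q) \<in> polygon_sides C" for p q
    proof -
      have pq: "p \<in> T" "q \<in> T" "p < q"
        using that T by (auto simp: mem_polygon_sides_iff)
      moreover have sideD: "(p, q) \<in> polygon_sides S \<union> D"
        using that C by (auto simp: cells_def)
      ultimately have "(p, q) \<in> polygon_sides T \<union> polygon_diagonals T"
        by (auto simp: polygon_diagonals_def)
      moreover have "(p, q) \<in> polygon_sides T" if "(p, q) \<in> polygon_sides S"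
        using that pq T unfolding mem_polygon_sides_iff by blast
      ultimately show ?thesis using sideD by blast
    qed
    then show ?thesis using C T by (auto simp: cells_def)
  qed
  have up: "C \<in> cells S D" if C: "C \<in> cells T (D \<inter> polygon_diagonals T)" and T: "T \<subseteq> S"
    and sides: "polygon_sides T \<subseteq> insert (a, b) (polygon_sides S)" for C T
  proof -
    have "polygon_diagonals C \<subseteq> polygon_diagonals T"
      using C by (intro polygon_diagonals_mono) (auto simp: cells_def)
    then show ?thesis using C T sides ab by (fastforce simp: cells_def)
  qed
  have "C \<in> cells S1 D1 \<union> cells S2 D2" if C: "C \<in> cells S D" for C
  proof -
    have "C \<subseteq> S1 \<or> C \<subseteq> S2"
      using cell_one_sided[OF finS D ab C] C by (auto simp: cells_def S1_def S2_def)
    then show ?thesis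
      using down[OF C, of S1] down[OF C, of S2] by (auto simp: D1_def D2_def S1_def S2_def)
  qed
  moreover have "cells S1 D1 \<union> cells S2 D2 \<subseteq> cells S D"
    using up[of _ S1] up[of _ S2] split_sides by (auto simp: D1_def D2_def S1_def S2_def)
  ultimately show ?thesis by blast
qed

lemma split_cells_disjoint: "cells S1 D1 \<inter> cells S2 D2 = {}"
proof -
  have False if "C \<subseteq> S1" "C \<subseteq> S2" "3 \<le> card C" for C
  proof -
    have "C \<subseteq> {a, b}" using that by (fastforce simp: S1_def S2_def)
    then have "card C \<le> card {a, b}" by (intro card_mono) auto
    with abS(3) that show False by simp
  qed
  then show ?thesis by (auto simp: cells_def)
qed

end

section \<open>Cells by induction on cuts\<close>

lemma finite_cells: "finite S \<Longrightarrow> finite (cells S D)"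
  by (rule finite_subset[of _ "Pow S"]) (auto simp: cells_def)

lemma finite_dissection: "finite S \<Longrightarrow> D \<in> dissections S \<Longrightarrow> finite D"
  using dissectionsD(1) finite_polygon_diagonals finite_subset by metis

text \<open>The cutting diagonal is a diagonal of neither piece, so both pieces carry strictly fewer
  diagonals than \<open>D\<close>. Facts on cells thus reduce to the undissected polygon and a
  single cut.\<close>

lemma dissection_induct [consumes 3, case_names empty split]:
  assumes "finite S" "3 \<le> card S" "D \<in> dissections S"
    and empty: "\<And>S. finite S \<Longrightarrow> 3 \<le> card S \<Longrightarrow> P S {}"
    and split: "\<And>S D a b. finite S \<Longrightarrow> D \<in> dissections S \<Longrightarrow> (a, b) \<in> D \<Longrightarrow>
      P (S \<inter> {a..b}) (D \<inter> polygon_diagonals (S \<inter> {a..b})) \<Longrightarrow>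
      P (S - {a<..<b}) (D \<inter> polygon_diagonals (S - {a<..<b})) \<Longrightarrow> P S D"
  shows "P S D"
  using assms(1-3)
proof (induction "card D" arbitrary: S D rule: less_induct)
  case less
  show ?case
  proof (cases "D = {}")
    case True
    with less.prems empty show ?thesis by blast
  next
    case False
    then obtain a b where ab: "(a, b) \<in> D" by auto
    note [simp] = finite_dissection[OF less.prems(1,3)]
    note facts = less.prems(1,3) ab
    note sd = split_dissection[OF facts]
    have "D \<inter> polygon_diagonals (S \<inter> {a..b}) \<subset> D" "D \<inter> polygon_diagonals (S - {a<..<b}) \<subset> D"
      using ab sd(2) by blast+
    then show ?thesis
      using split[OF facts] less.hyps psubset_card_mono[OF \<open>finite D\<close>]
        split_finite[OF facts] split_card[OF facts] split_dissections[OF facts] by blast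
  qed
qed

lemma card_cells:
  assumes "finite S" "3 \<le> card S" "D \<in> dissections S"
  shows "card (cells S D) = card D + 1"
  using assms
proof (induction rule: dissection_induct)
  case (empty S)
  then show ?case by (simp add: cells_empty)
next
  case (split S D a b)
  note facts = split(1-3)
  note sd = split_dissection[OF facts]
  let ?D1 = "D \<inter> polygon_diagonals (S \<inter> {a..b})" and ?D2 = "D \<inter> polygon_diagonals (S - {a<..<b})"
  have fin: "finite ?D1" "finite ?D2"
    using finite_dissection[OF split(1,2)] by simp_all
  have "card D = Suc (card (?D1 \<union> ?D2))"
    by (subst (1) sd(1)) (use sd(2) fin in simp)
  also have "card (?D1 \<union> ?D2) = card ?D1 + card ?D2"
    by (intro card_Un_disjoint fin sd(3))
  finally show ?case
    using card_Un_disjoint[OF _ _ split_cells_disjoint[OF facts]] finite_cells split_finite[OF facts] split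
    by (simp add: split_cells[OF facts])
qed

lemma sum_cells:
  assumes "finite S" "3 \<le> card S" "D \<in> dissections S"
  shows "(\<Sum>C\<in>cells S D. card C - 2) = card S - 2"
  using assms
proof (induction rule: dissection_induct)
  case (empty S)
  then show ?case by (simp add: cells_empty)
next
  case (split S D a b)
  note facts = split(1-3)
  show ?case
    using sum.union_disjoint[OF _ _ split_cells_disjoint[OF facts], of "\<lambda>C. card C - 2"]
      finite_cells split_finite[OF facts] split split_card[OF facts]
    by (simp add: split_cells[OF facts])
qed

text \<open>Two cells on different sides of a cut have diagonals in different pieces, which are
  distinct and do not cross; for cells within one piece the induction hypothesis applies.\<close>

lemma cell_diagonals:
  assumes "finite S" "3 \<le> card S" "D \<in> dissections S"
  shows "(\<Union>C\<in>cells S D. polygon_diagonals C) = free_diagonals S D \<and>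
    (\<forall>C\<in>cells S D. \<forall>C'\<in>cells S D. \<forall>d\<in>polygon_diagonals C. \<forall>e\<in>polygon_diagonals C'.
      C \<noteq> C' \<longrightarrow> d \<noteq> e \<and> \<not> crossing d e)"
  using assms
proof (induction rule: dissection_induct)
  case (empty S)
  then show ?case by (simp add: cells_empty free_diagonals_def)
next
  case (split S D a b)
  note facts = split(1-3)
  let ?S1 = "S \<inter> {a..b}" and ?S2 = "S - {a<..<b}"
  let ?D1 = "D \<inter> polygon_diagonals ?S1" and ?D2 = "D \<inter> polygon_diagonals ?S2"
  have cross: "d \<noteq> e \<and> \<not> crossing d e \<and> \<not> crossing e d"
    if "C \<in> cells ?S1 ?D1" "C' \<in> cells ?S2 ?D2" "d \<in> polygon_diagonals C" "e \<in> polygon_diagonals C'"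
    for C C' d e
  proof -
    have "polygon_diagonals C \<subseteq> polygon_diagonals ?S1" "polygon_diagonals C' \<subseteq> polygon_diagonals ?S2"
      using that by (auto simp: cells_def intro!: polygon_diagonals_mono)
    then show ?thesis
      using split_not_crossing[OF facts, of d e] split_diagonals_disjoint[OF facts] that by blast
  qed
  show ?case
    unfolding split_cells[OF facts] split_free_diagonals[OF facts] UN_Un ball_Un
    using split(4,5) by (intro conjI ballI impI) (use cross in \<open>simp; fail | metis\<close>)+
qed

section \<open>Crossing graphs\<close>

text \<open>Used both for graphs and for inclusion orders. Sets of diagonals are ordered by reversed
  inclusion, since adding diagonals shrinks the face.\<close>

definition rel_iso ::
    "('v \<Rightarrow> 'w) \<Rightarrow> 'v set \<Rightarrow> ('v \<Rightarrow> 'v \<Rightarrow> bool) \<Rightarrow> 'w set \<Rightarrow> ('w \<Rightarrow> 'w \<Rightarrow> bool) \<Rightarrow> bool" where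
  "rel_iso g V R W Q \<longleftrightarrow> bij_betw g V W \<and> (\<forall>x\<in>V. \<forall>y\<in>V. R x y \<longleftrightarrow> Q (g x) (g y))"

lemma rel_iso_inv:
  assumes "rel_iso g V R W Q"
  shows "rel_iso (inv_into V g) W Q V R"
proof -
  have g: "bij_betw g V W" using assms by (simp add: rel_iso_def)
  note inv = bij_betw_inv_into[OF g]
  moreover have "Q x y \<longleftrightarrow> R (inv_into V g x) (inv_into V g y)" if "x \<in> W" "y \<in> W" for x y
    using assms that bij_betw_inv_into_right[OF g] bij_betw_apply[OF inv] by (simp add: rel_iso_def)
  ultimately show ?thesis by (simp add: rel_iso_def)
qed

lemma rel_iso_comp:
  assumes "rel_iso g V R W Q" "rel_iso h W Q X T"
  shows "rel_iso (h \<circ> g) V R X T"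
proof -
  have "bij_betw g V W" "bij_betw h W X" using assms by (simp_all add: rel_iso_def)
  then show ?thesis
    using assms bij_betw_apply[of g V W] by (simp add: rel_iso_def bij_betw_trans)
qed

text \<open>The edge relation of a disjoint union of graphs, each vertex being tagged with the index
  of its summand.\<close>

definition sum_rel :: "('v \<Rightarrow> 'v \<Rightarrow> bool) \<Rightarrow> 'i \<times> 'v \<Rightarrow> 'i \<times> 'v \<Rightarrow> bool" where
  "sum_rel R x y \<longleftrightarrow> fst x = fst y \<and> R (snd x) (snd y)"

text \<open>Sides, diagonals and crossings are defined by comparing labels only, so any increasing
  relabelling preserves them.\<close>

lemma strict_mono_on_relabel:
  assumes h: "strict_mono_on A h"
  shows "map_prod h h ` polygon_sides A = polygon_sides (h ` A)"
    and "rel_iso (map_prod h h) (polygon_diagonals A) crossing (polygon_diagonals (h ` A)) crossing"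
    and "inj_on (map_prod h h) (polygon_sides A)"
proof -
  have less: "h x < h y \<longleftrightarrow> x < y" if "x \<in> A" "y \<in> A" for x y
    using h that by (simp add: strict_mono_on_less)
  then have le: "h x \<le> h y \<longleftrightarrow> x \<le> y" if "x \<in> A" "y \<in> A" for x y
    using that by (meson not_le)
  have inj: "inj_on (map_prod h h) (A \<times> A)"
    using strict_mono_on_imp_inj_on[OF h] by (rule map_prod_inj_on) (rule strict_mono_on_imp_inj_on[OF h])
  then show "inj_on (map_prod h h) (polygon_sides A)"
    by (rule inj_on_subset) (auto simp: mem_polygon_sides_iff)
  have sides: "(h x, h y) \<in> polygon_sides (h ` A) \<longleftrightarrow> (x, y) \<in> polygon_sides A"
    if "x \<in> A" "y \<in> A" for x y
    using that by (simp add: mem_polygon_sides_iff less le)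
  have diags: "(h x, h y) \<in> polygon_diagonals (h ` A) \<longleftrightarrow> (x, y) \<in> polygon_diagonals A"
    if "x \<in> A" "y \<in> A" for x y
    using that by (simp add: mem_polygon_diagonals_iff less)
  show "map_prod h h ` polygon_sides A = polygon_sides (h ` A)"
  proof
    show "map_prod h h ` polygon_sides A \<subseteq> polygon_sides (h ` A)"
      using sides by (auto simp: mem_polygon_sides_iff[of _ _ A])
  next
    show "polygon_sides (h ` A) \<subseteq> map_prod h h ` polygon_sides A"
    proof (rule subrelI)
      fix p q assume pq: "(p, q) \<in> polygon_sides (h ` A)"
      then obtain x y where "x \<in> A" "y \<in> A" "p = h x" "q = h y"
        by (auto simp: mem_polygon_sides_iff)
      with pq sides show "(p, q) \<in> map_prod h h ` polygon_sides A"
        by (auto intro!: image_eqI[of _ _ "(x, y)"])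
    qed
  qed
  have "map_prod h h ` polygon_diagonals A = polygon_diagonals (h ` A)"
  proof
    show "map_prod h h ` polygon_diagonals A \<subseteq> polygon_diagonals (h ` A)"
      using diags by (auto simp: mem_polygon_diagonals_iff[of _ _ A])
  next
    show "polygon_diagonals (h ` A) \<subseteq> map_prod h h ` polygon_diagonals A"
    proof (rule subrelI)
      fix p q assume pq: "(p, q) \<in> polygon_diagonals (h ` A)"
      then obtain x y where "x \<in> A" "y \<in> A" "p = h x" "q = h y"
        by (auto simp: mem_polygon_diagonals_iff)
      with pq diags show "(p, q) \<in> map_prod h h ` polygon_diagonals A"
        by (auto intro!: image_eqI[of _ _ "(x, y)"])
    qed
  qed
  moreover have "inj_on (map_prod h h) (polygon_diagonals A)"
    using inj by (rule inj_on_subset) (auto simp: mem_polygon_diagonals_iff)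
  moreover have "crossing d e \<longleftrightarrow> crossing (map_prod h h d) (map_prod h h e)"
    if "d \<in> polygon_diagonals A" "e \<in> polygon_diagonals A" for d e
    using that by (cases d; cases e) (simp add: crossing_def less mem_polygon_diagonals_iff)
  ultimately show "rel_iso (map_prod h h) (polygon_diagonals A) crossing (polygon_diagonals (h ` A)) crossing"
    by (simp add: rel_iso_def bij_betw_def)
qed

text \<open>The standard copy ends at \<open>card C - 1\<close>, which is also the index of the
  associahedron belonging to a polygon with \<open>card C\<close> vertices.\<close>

lemma relabel_polygon:
  fixes C :: "nat set"
  assumes "finite C" "C \<noteq> {}"
  obtains h where "strict_mono_on {0..card C - 1} h" "h ` {0..card C - 1} = C"
proof -
  have "{0..card C - 1} = {..<card C}"
    using assms card_gt_0_iff[of C] by auto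
  with ex_bij_betw_strict_mono_card[OF assms(1)] that show thesis
    by (metis bij_betw_imp_surj_on)
qed

lemma num_sides_eq_card:
  assumes "3 \<le> card C"
  shows "num_sides C = card C"
proof -
  have fin: "finite C" "C \<noteq> {}" using assms by (auto intro: card_ge_0_finite)
  obtain h where h: "strict_mono_on {0..card C - 1} h" "h ` {0..card C - 1} = C"
    using relabel_polygon[OF fin] .
  define m where "m = card C - 1"
  have m: "2 \<le> m" "card C = Suc m" using assms by (auto simp: m_def)
  have "polygon_sides {0..m} = insert (0, m) ((\<lambda>i. (i, Suc i)) ` {0..<m})"
    (is "_ = insert _ ?E")
  proof
    show "insert (0, m) ?E \<subseteq> polygon_sides {0..m}"
      using m by (auto simp: mem_polygon_sides_iff)
    have "a = 0 \<and> b = m" if ab: "(a, b) \<in> polygon_sides {0..m}" "(a, b) \<notin> ?E" for a b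
    proof -
      have "a < b" "b \<le> m" using ab by (auto simp: mem_polygon_sides_iff)
      with ab have "b \<noteq> Suc a" by auto
      with \<open>a < b\<close> \<open>b \<le> m\<close> have "\<not> (\<forall>y\<in>{0..m}. y \<le> a \<or> b \<le> y)"
        by (auto intro!: bexI[of _ "Suc a"])
      with ab have "\<forall>y\<in>{0..m}. a \<le> y \<and> y \<le> b"
        by (simp add: mem_polygon_sides_iff)
      from bspec[OF this, of 0] bspec[OF this, of m] \<open>b \<le> m\<close> show ?thesis by simp
    qed
    then show "polygon_sides {0..m} \<subseteq> insert (0, m) ?E" by auto
  qed
  \<comment> \<open>As m \<ge> 2, the closing side \<open>(0, m)\<close> is not one of the m pairs
    of neighbours.\<close>
  then have "card (polygon_sides {0..m}) = Suc m"
    using m by (auto simp: card_image inj_on_def card_insert_if)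
  moreover have "card (polygon_sides C) = card (polygon_sides {0..m})"
    using card_image[OF strict_mono_on_relabel(3)[OF h(1)]]
    unfolding strict_mono_on_relabel(1)[OF h(1)] h(2) m_def .
  ultimately show ?thesis
    using m by (simp add: num_sides_def)
qed

text \<open>The index set is left open for three uses: indexing the cells by themselves, by the
  cells of another dissection with matching sizes, and by the index type of a product polytope.
  Separation of the cells by \<open>cell_diagonals\<close> makes the combined relabelling injective
  and free of edges between different indices.\<close>

lemma free_diagonals_iso:
  assumes S: "finite S" "3 \<le> card S" and D: "D \<in> dissections S"
    and \<beta>: "bij_betw \<beta> I (cells S D)"
  shows "\<exists>g. rel_iso g (SIGMA i:I. polygon_diagonals {0..card (\<beta> i) - 1}) (sum_rel crossing)
    (free_diagonals S D) crossing"
proof -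
  let ?V = "SIGMA i:I. polygon_diagonals {0..card (\<beta> i) - 1}"
  have cell: "\<beta> i \<in> cells S D" if "i \<in> I" for i using \<beta> that by (auto dest: bij_betw_apply)
  have "\<exists>h. strict_mono_on {0..card (\<beta> i) - 1} h \<and> h ` {0..card (\<beta> i) - 1} = \<beta> i" if "i \<in> I" for i
  proof -
    have "finite (\<beta> i)" "\<beta> i \<noteq> {}"
      using cell[OF that] S finite_subset by (auto simp: cells_def)
    then show ?thesis using relabel_polygon by metis
  qed
  then obtain h where h: "\<And>i. i \<in> I \<Longrightarrow> strict_mono_on {0..card (\<beta> i) - 1} (h i)"
    "\<And>i. i \<in> I \<Longrightarrow> h i ` {0..card (\<beta> i) - 1} = \<beta> i" by metis
  define g where "g = (\<lambda>(i, d). map_prod (h i) (h i) d)"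
  have iso: "bij_betw (\<lambda>d. g (i, d)) (polygon_diagonals {0..card (\<beta> i) - 1}) (polygon_diagonals (\<beta> i))"
    "\<And>d e. d \<in> polygon_diagonals {0..card (\<beta> i) - 1} \<Longrightarrow> e \<in> polygon_diagonals {0..card (\<beta> i) - 1} \<Longrightarrow>
       crossing (g (i, d)) (g (i, e)) \<longleftrightarrow> crossing d e" if "i \<in> I" for i
    using strict_mono_on_relabel(2)[OF h(1)[OF that]] h(2)[OF that] by (auto simp: rel_iso_def g_def)
  have sep: "d \<noteq> e \<and> \<not> crossing d e"
    if "i \<in> I" "j \<in> I" "i \<noteq> j" "d \<in> polygon_diagonals (\<beta> i)" "e \<in> polygon_diagonals (\<beta> j)" for i j d e
    using that cell_diagonals[OF S D] cell bij_betw_imp_inj_on[OF \<beta>] by (metis inj_onD)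
  have mem: "g (i, d) \<in> polygon_diagonals (\<beta> i)"
    if "i \<in> I" "d \<in> polygon_diagonals {0..card (\<beta> i) - 1}" for i d
    using iso(1)[OF that(1)] that(2) by (rule bij_betw_apply)
  have "g ` ?V = (\<Union>i\<in>I. polygon_diagonals (\<beta> i))"
    using iso(1)[THEN bij_betw_imp_surj_on] by force
  also have "\<dots> = (\<Union>C\<in>cells S D. polygon_diagonals C)"
    by (simp flip: bij_betw_imp_surj_on[OF \<beta>])
  finally have surj: "g ` ?V = free_diagonals S D"
    using cell_diagonals[OF S D] by simp
  have "g (i, d) = g (j, e) \<longleftrightarrow> (i, d) = (j, e)"
    "crossing (g (i, d)) (g (j, e)) \<longleftrightarrow> sum_rel crossing (i, d) (j, e)"
    if "(i, d) \<in> ?V" "(j, e) \<in> ?V" for i d j e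
  proof -
    have *: "i \<in> I" "j \<in> I" "d \<in> polygon_diagonals {0..card (\<beta> i) - 1}"
      "e \<in> polygon_diagonals {0..card (\<beta> j) - 1}"
      using that by blast+
    have 1: "g (i, d) = g (i, e) \<longleftrightarrow> d = e" if "i = j"
      using inj_on_eq_iff[OF bij_betw_imp_inj_on[OF iso(1)[OF *(1)]]] * that by metis
    have 2: "g (i, d) \<noteq> g (j, e) \<and> \<not> crossing (g (i, d)) (g (j, e))" if "i \<noteq> j"
      using sep[OF *(1,2) that mem[OF *(1,3)] mem[OF *(2,4)]] .
    show "g (i, d) = g (j, e) \<longleftrightarrow> (i, d) = (j, e)"
      using 1 2 by (cases "i = j") auto
    show "crossing (g (i, d)) (g (j, e)) \<longleftrightarrow> sum_rel crossing (i, d) (j, e)"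
      using 2 iso(2)[OF *(1), of d e] * by (cases "i = j") (auto simp: sum_rel_def)
  qed
  then have "inj_on g ?V" "\<And>x y. x \<in> ?V \<Longrightarrow> y \<in> ?V \<Longrightarrow> sum_rel crossing x y \<longleftrightarrow> crossing (g x) (g y)"
    unfolding inj_on_def by (metis surj_pair)+
  then have "rel_iso g ?V (sum_rel crossing) (free_diagonals S D) crossing"
    using surj by (simp add: rel_iso_def bij_betw_def)
  then show ?thesis by blast
qed

text \<open>Distance at most two in the graph. The crossing graph of a single cell has diameter at
  most two, so this replaces the transitive closure in describing components.\<close>

definition near :: "'v set \<Rightarrow> ('v \<Rightarrow> 'v \<Rightarrow> bool) \<Rightarrow> 'v \<Rightarrow> 'v \<Rightarrow> bool" where
  "near V R x y \<longleftrightarrow> x = y \<or> R x y \<or> (\<exists>z\<in>V. R x z \<and> R z y)"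

lemma rel_iso_near:
  assumes "rel_iso g V R W Q" "x \<in> V" "y \<in> V"
  shows "near W Q (g x) (g y) \<longleftrightarrow> near V R x y"
proof -
  have "W = g ` V" "inj_on g V" using assms by (auto simp: rel_iso_def bij_betw_def)
  moreover from this have "(\<exists>z\<in>W. Q (g x) z \<and> Q z (g y)) \<longleftrightarrow> (\<exists>z\<in>V. R x z \<and> R z y)"
    using assms by (simp add: rel_iso_def)
  ultimately show ?thesis
    using assms by (simp add: near_def rel_iso_def inj_on_eq_iff)
qed

text \<open>A common crosser of two non-crossing diagonals joins a vertex beyond the one to a vertex
  beyond the other.\<close>

lemma near_polygon_diagonals:
  assumes "d \<in> polygon_diagonals C" "e \<in> polygon_diagonals C"
  shows "near (polygon_diagonals C) crossing d e"
proof -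
  \<comment> \<open>Two diagonals that do not cross are, up to exchanging them, side by side or
    nested.\<close>
  have *: "near (polygon_diagonals C) crossing (a, b) (c, f)"
    if ab: "(a, b) \<in> polygon_diagonals C" and cf: "(c, f) \<in> polygon_diagonals C"
      and pos: "b \<le> c \<or> a \<le> c \<and> f \<le> b" for a b c f
  proof -
    \<comment> \<open>A chord of \<open>C\<close> that crosses \<open>(c, f)\<close> is
      automatically a diagonal, since \<open>c\<close> and \<open>f\<close> lie strictly on its two
      sides.\<close>
    have common: ?thesis if "x \<in> C" "y \<in> C" "x < y" "crossing (a, b) (x, y)" "crossing (x, y) (c, f)" for x y
    proof -
      have "c \<in> C" "f \<in> C" using cf by (auto simp: mem_polygon_diagonals_iff)
      with that(1-3,5) have "(x, y) \<in> polygon_diagonals C"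
        by (auto simp: mem_polygon_diagonals_iff crossing_def)
      with that(4,5) show ?thesis by (auto simp: near_def)
    qed
    obtain y where y: "y \<in> C" "c < y" "y < f"
      using cf by (auto simp: mem_polygon_diagonals_iff)
    have "a < b" using ab by (simp add: mem_polygon_diagonals_iff)
    from pos show ?thesis
    proof
      assume "b \<le> c"
      moreover obtain x where "x \<in> C" "a < x" "x < b"
        using ab by (auto simp: mem_polygon_diagonals_iff)
      ultimately show ?thesis using common[of x y] y by (auto simp: crossing_def)
    next
      assume "a \<le> c \<and> f \<le> b"
      moreover obtain x where "x \<in> C" "x < a \<or> b < x"
        using ab by (auto simp: mem_polygon_diagonals_iff)
      ultimately show ?thesis
        using common[of x y] common[of y x] y by (auto simp: crossing_def)
    qed
  qed
  obtain a b c f where de: "d = (a, b)" "e = (c, f)" by (cases d; cases e)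
  then have "a < b" "c < f" using assms by (auto simp: mem_polygon_diagonals_iff)
  then consider "crossing d e" | "b \<le> c \<or> a \<le> c \<and> f \<le> b" | "f \<le> a \<or> c \<le> a \<and> b \<le> f"
    unfolding de crossing_def fst_conv snd_conv by linarith
  then show ?thesis
  proof cases
    case 1
    then show ?thesis by (simp add: near_def)
  next
    case 2
    then show ?thesis using * assms by (simp add: de)
  next
    case 3
    then have "near (polygon_diagonals C) crossing e d" using * assms by (simp add: de)
    then show ?thesis by (metis near_def crossing_sym)
  qed
qed

section \<open>Partitions and crossing graphs\<close>

lemma card_cell_ge: "C \<in> cells S D \<Longrightarrow> 3 \<le> card C"
  by (simp add: cells_def)

lemma cell_partition_in_partitions_into:
  assumes S: "finite S" "3 \<le> card S" and D: "D \<in> dissections S"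
  shows "cell_partition S D \<in> partitions_into (card D + 1) (card S - 2)"
proof -
  have "num_sides C - 2 = card C - 2" "0 < card C - 2" if "C \<in> cells S D" for C
    using card_cell_ge[OF that] num_sides_eq_card by simp_all
  then show ?thesis
    using card_cells[OF S D] sum_cells[OF S D] finite_cells[OF S(1), of D]
    by (auto simp: partitions_into_def cell_partition_def simp flip: sum_unfold_sum_mset)
qed

lemma card_polygon_diagonals:
  assumes "finite C" "C \<noteq> {}"
  shows "card (polygon_diagonals C) = card (polygon_diagonals {0..card C - 1})"
  using relabel_polygon[OF assms] strict_mono_on_relabel(2) bij_betw_same_card
  by (metis rel_iso_def)

text \<open>The closing side \<open>(0, m)\<close> of the smaller polygon becomes a diagonal of the
  larger one. So the number of diagonals determines the number of sides. The count starts to grow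
  only at the triangle: \<open>{0..1}\<close> and \<open>{0..2}\<close> both have none.\<close>

lemma card_polygon_diagonals_less:
  assumes "2 \<le> m" "m < n"
  shows "card (polygon_diagonals {0..m}) < card (polygon_diagonals {0..n})"
proof (rule psubset_card_mono)
  have "(0, m) \<in> polygon_diagonals {0..n}" "(0, m) \<notin> polygon_diagonals {0..m}"
    using assms by (auto simp: mem_polygon_diagonals_iff intro: bexI[of _ 1] bexI[of _ n])
  moreover have "polygon_diagonals {0..m} \<subseteq> polygon_diagonals {0..n}"
    using assms by (intro polygon_diagonals_mono) auto
  ultimately show "polygon_diagonals {0..m} \<subset> polygon_diagonals {0..n}" by blast
qed (simp add: finite_polygon_diagonals)

text \<open>Equality and crossing never leave a cell, so two crossings do not either; conversely,
  the common crosser given by \<open>near_polygon_diagonals\<close> is a diagonal of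
  \<open>C\<close>, hence free.\<close>

lemma near_class_eq_cell_diagonals:
  assumes S: "finite S" "3 \<le> card S" and D: "D \<in> dissections S"
    and C: "C \<in> cells S D" and d: "d \<in> polygon_diagonals C"
  shows "{e \<in> free_diagonals S D. near (free_diagonals S D) crossing d e} = polygon_diagonals C"
proof -
  have free: "free_diagonals S D = (\<Union>C\<in>cells S D. polygon_diagonals C)"
    and sep: "\<And>C C' d e. C \<in> cells S D \<Longrightarrow> C' \<in> cells S D \<Longrightarrow> d \<in> polygon_diagonals C \<Longrightarrow>
      e \<in> polygon_diagonals C' \<Longrightarrow> d = e \<or> crossing d e \<Longrightarrow> C = C'"
    using cell_diagonals[OF S D] by blast+
  have "e \<in> polygon_diagonals C" if e: "e \<in> free_diagonals S D" "near (free_diagonals S D) crossing d e" for e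
  proof -
    obtain C' where C': "C' \<in> cells S D" "e \<in> polygon_diagonals C'"
      using e(1) free by blast
    from e(2) consider "d = e \<or> crossing d e"
      | z where "z \<in> free_diagonals S D" "crossing d z" "crossing z e"
      by (auto simp: near_def)
    then have "C = C'"
    proof cases
      case 1
      then show ?thesis using sep[OF C C'(1) d C'(2)] by blast
    next
      case 2
      then obtain C'' where C'': "C'' \<in> cells S D" "z \<in> polygon_diagonals C''"
        using free by blast
      then show ?thesis
        using sep[OF C C''(1) d C''(2)] sep[OF C''(1) C'(1) C''(2) C'(2)] 2 by blast
    qed
    with C' show ?thesis by simp
  qed
  moreover have sub: "polygon_diagonals C \<subseteq> free_diagonals S D"
    using free C by blast
  moreover have "near (free_diagonals S D) crossing d e" if "e \<in> polygon_diagonals C" for e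
    using near_polygon_diagonals[OF d that] sub by (auto simp: near_def)
  ultimately show ?thesis by blast
qed

text \<open>Vertices are counted instead of classes, which avoids forming a quotient; when
  \<open>near\<close> partitions the vertices, the value is \<open>c\<close> times the number of
  classes of size \<open>c\<close>.\<close>

definition near_count :: "'v set \<Rightarrow> ('v \<Rightarrow> 'v \<Rightarrow> bool) \<Rightarrow> nat \<Rightarrow> nat" where
  "near_count V R c = card {x \<in> V. card {y \<in> V. near V R x y} = c}"

lemma rel_iso_near_count:
  assumes g: "rel_iso g V R W Q"
  shows "near_count V R c = near_count W Q c"
proof -
  have W: "W = g ` V" and inj: "inj_on g V"
    using g by (auto simp: rel_iso_def bij_betw_def)
  have "{y \<in> W. near W Q (g x) y} = g ` {y \<in> V. near V R x y}" if "x \<in> V" for x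
  proof -
    have "{y \<in> W. near W Q (g x) y} = g ` {y \<in> V. near W Q (g x) (g y)}"
      unfolding W by blast
    also have "{y \<in> V. near W Q (g x) (g y)} = {y \<in> V. near V R x y}"
      using rel_iso_near[OF g that] by blast
    finally show ?thesis .
  qed
  then have card_class: "card {y \<in> W. near W Q (g x) y} = card {y \<in> V. near V R x y}" if "x \<in> V" for x
    using that card_image[OF inj_on_subset[OF inj]] by simp
  have "{x \<in> W. card {y \<in> W. near W Q x y} = c} = g ` {x \<in> V. card {y \<in> W. near W Q (g x) y} = c}"
    using W by blast
  also have "{x \<in> V. card {y \<in> W. near W Q (g x) y} = c} = {x \<in> V. card {y \<in> V. near V R x y} = c}"
    using card_class by auto
  finally show ?thesis
    unfolding near_count_def using card_image[OF inj_on_subset[OF inj]] by simp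
qed

text \<open>The class of a diagonal is the set of diagonals of its cell, and its size singles out
  the cells with m + 1 sides. For m = 2 the equation reads 0 = 0 and says nothing on
  triangles.\<close>

lemma near_count_free_diagonals:
  assumes S: "finite S" "3 \<le> card S" and D: "D \<in> dissections S" and m: "2 \<le> m"
  shows "near_count (free_diagonals S D) crossing (card (polygon_diagonals {0..m})) =
    card {C \<in> cells S D. card C - 1 = m} * card (polygon_diagonals {0..m})"
proof -
  let ?V = "free_diagonals S D"
  have C: "finite C" "card (polygon_diagonals C) = card (polygon_diagonals {0..card C - 1})"
    "card (polygon_diagonals C) = card (polygon_diagonals {0..m}) \<longleftrightarrow> card C - 1 = m"
    if "C \<in> cells S D" for C
  proof -
    show fin: "finite C" using that card_cell_ge[OF that] by (auto intro: card_ge_0_finite)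
    show *: "card (polygon_diagonals C) = card (polygon_diagonals {0..card C - 1})"
      using card_cell_ge[OF that] by (intro card_polygon_diagonals fin) auto
    show "card (polygon_diagonals C) = card (polygon_diagonals {0..m}) \<longleftrightarrow> card C - 1 = m"
      unfolding * using card_polygon_diagonals_less[of m "card C - 1"]
        card_polygon_diagonals_less[of "card C - 1" m] m card_cell_ge[OF that]
      by (cases "card C - 1" m rule: linorder_cases) (fastforce dest: less_imp_neq)+
  qed
  have free: "?V = (\<Union>C\<in>cells S D. polygon_diagonals C)"
    using cell_diagonals[OF S D] by blast
  have uniq: "C = C'" if "C \<in> cells S D" "C' \<in> cells S D" "d \<in> polygon_diagonals C" "d \<in> polygon_diagonals C'"
    for C C' d
    using cell_diagonals[OF S D] that by metis
  have "{d \<in> ?V. card {e \<in> ?V. near ?V crossing d e} = card (polygon_diagonals {0..m})} =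
    (\<Union>C\<in>{C \<in> cells S D. card C - 1 = m}. polygon_diagonals C)" (is "?L = ?R")
  proof (intro set_eqI)
    fix d
    show "d \<in> ?L \<longleftrightarrow> d \<in> ?R"
    proof (cases "d \<in> ?V")
      case True
      then obtain C where dC: "C \<in> cells S D" "d \<in> polygon_diagonals C" using free by blast
      have "d \<in> ?L \<longleftrightarrow> card C - 1 = m"
        using True near_class_eq_cell_diagonals[OF S D dC] C(3)[OF dC(1)] by simp
      moreover have "d \<in> ?R \<longleftrightarrow> card C - 1 = m"
        using dC uniq[OF dC(1) _ dC(2)] by blast
      ultimately show ?thesis by blast
    next
      case False
      with free show ?thesis by blast
    qed
  qed
  moreover have "card ?R = (\<Sum>C\<in>{C \<in> cells S D. card C - 1 = m}. card (polygon_diagonals C))"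
  proof (intro card_UN_disjoint ballI impI)
    show "finite {C \<in> cells S D. card C - 1 = m}"
      using finite_cells[OF S(1)] by simp
  qed (use C(1) uniq finite_polygon_diagonals in blast)+
  ultimately show ?thesis
    using C(2) by (simp add: near_count_def)
qed

text \<open>A part \<open>x\<close> stands for a cell with x + 2 vertices, whose standard copy is
  \<open>{0..x + 1}\<close>; hence the shift by one.\<close>

lemma count_cell_partition:
  assumes "finite S" "0 < x"
  shows "count (cell_partition S D) x = card {C \<in> cells S D. card C - 1 = Suc x}"
proof -
  have "num_sides C - 2 = x \<longleftrightarrow> card C - 1 = Suc x" if "C \<in> cells S D" for C
    using card_cell_ge[OF that] num_sides_eq_card[of C] by auto
  then have "{C \<in> cells S D. num_sides C - 2 = x} = {C \<in> cells S D. card C - 1 = Suc x}"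
    by blast
  then show ?thesis
    using finite_cells[OF assms(1), of D]
    by (simp add: cell_partition_def count_image_mset_eq_card_vimage)
qed

text \<open>Triangles have no diagonals and hence are invisible in the graph; their number is
  recovered from the total number of cells.\<close>

lemma cell_partition_eq_of_iso:
  assumes S: "finite S" "3 \<le> card S" and D: "D \<in> dissections S" "D' \<in> dissections S"
    and card: "card D = card D'"
    and g: "rel_iso g (free_diagonals S D) crossing (free_diagonals S D') crossing"
  shows "cell_partition S D = cell_partition S D'"
proof -
  let ?M = "cell_partition S D" and ?N = "cell_partition S D'"
  have pos: "count ?M 0 = 0" "count ?N 0 = 0" and size: "size ?M = size ?N"
    using cell_partition_in_partitions_into[OF S D(1)] cell_partition_in_partitions_into[OF S D(2)] card
    by (auto simp: partitions_into_def count_eq_zero_iff)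
  have count: "count ?M x = count ?N x" if "x \<noteq> 1" for x
  proof (cases "x = 0")
    case True
    with pos show ?thesis by simp
  next
    case False
    with that have x: "2 \<le> x" by simp
    let ?\<delta> = "card (polygon_diagonals {0..Suc x})"
    \<comment> \<open>The polygon has more sides than a triangle, hence strictly more diagonals;
      positivity allows the factor to be cancelled below.\<close>
    have "0 < ?\<delta>" using card_polygon_diagonals_less[of 2 "Suc x"] x by simp
    moreover have "count ?M x * ?\<delta> = count ?N x * ?\<delta>"
    proof -
      have "0 < x" "2 \<le> Suc x" using x by simp_all
      note cp = count_cell_partition[OF S(1) \<open>0 < x\<close>]
      have "count ?M x * ?\<delta> = near_count (free_diagonals S D) crossing ?\<delta>"
        unfolding cp by (rule near_count_free_diagonals[OF S D(1) \<open>2 \<le> Suc x\<close>, symmetric])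
      also have "\<dots> = near_count (free_diagonals S D') crossing ?\<delta>"
        by (rule rel_iso_near_count[OF g])
      also have "\<dots> = count ?N x * ?\<delta>"
        unfolding cp by (rule near_count_free_diagonals[OF S D(2) \<open>2 \<le> Suc x\<close>])
      finally show ?thesis .
    qed
    ultimately show ?thesis by simp
  qed
  have "filter_mset (\<lambda>x. x \<noteq> 1) ?M = filter_mset (\<lambda>x. x \<noteq> 1) ?N"
    using count by (intro multiset_eqI) simp
  moreover have "size M = count M 1 + size (filter_mset (\<lambda>x. x \<noteq> 1) M)" for M :: "nat multiset"
    using arg_cong[OF multiset_partition[of M "\<lambda>x. x = 1"], of size]
    by (simp add: filter_eq_replicate_mset)
  ultimately have "count ?M 1 = count ?N 1" using size by (metis add_right_cancel)
  with count show ?thesis by (metis multiset_eqI)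
qed

text \<open>Equal sizes give some bijection between \<open>A\<close> and \<open>B\<close>; a
  permutation of \<open>A\<close> then corrects it so that the values match.\<close>

lemma image_mset_eq_obtains_bij_betw:
  assumes "finite A" "finite B" and eq: "image_mset f (mset_set A) = image_mset g (mset_set B)"
  obtains \<beta> where "bij_betw \<beta> A B" "\<And>x. x \<in> A \<Longrightarrow> f x = g (\<beta> x)"
proof -
  have "card A = card B"
    using eq by (metis size_image_mset size_mset_set)
  then obtain h where h: "bij_betw h A B"
    using finite_same_card_bij assms by blast
  then have "image_mset f (mset_set A) = image_mset (g \<circ> h) (mset_set A)"
    using eq by (simp add: multiset.map_comp[symmetric] image_mset_mset_set bij_betw_def)
  then obtain p where "p permutes A" "\<forall>x\<in>A. f x = (g \<circ> h) (p x)"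
    using image_mset_eq_implies_permutes[OF \<open>finite A\<close>] by metis
  with that[of "h \<circ> p"] h show thesis
    using bij_betw_trans permutes_imp_bij by fastforce
qed

text \<open>Matching cells with equally many sides makes both graphs isomorphic to one and the same
  disjoint union of standard crossing graphs.\<close>

lemma iso_of_cell_partition_eq:
  assumes S: "finite S" "3 \<le> card S" and D: "D \<in> dissections S" "D' \<in> dissections S"
    and eq: "cell_partition S D = cell_partition S D'"
  shows "\<exists>g. rel_iso g (free_diagonals S D) crossing (free_diagonals S D') crossing"
proof -
  obtain \<beta> where \<beta>: "bij_betw \<beta> (cells S D) (cells S D')"
    and sides: "\<And>C. C \<in> cells S D \<Longrightarrow> num_sides C - 2 = num_sides (\<beta> C) - 2"
    using image_mset_eq_obtains_bij_betw[OF finite_cells[OF S(1)] finite_cells[OF S(1)]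
        eq[unfolded cell_partition_def]] by blast
  have "card (\<beta> C) = card C" if "C \<in> cells S D" for C
    using sides[OF that] card_cell_ge[OF that] card_cell_ge[OF bij_betw_apply[OF \<beta> that]]
    by (simp add: num_sides_eq_card)
  then have "(SIGMA C:cells S D. polygon_diagonals {0..card (\<beta> C) - 1}) =
    (SIGMA C:cells S D. polygon_diagonals {0..card C - 1})"
    by (intro Sigma_cong) simp_all
  then obtain g h where
    "rel_iso g (SIGMA C:cells S D. polygon_diagonals {0..card C - 1}) (sum_rel crossing)
      (free_diagonals S D') crossing"
    "rel_iso h (SIGMA C:cells S D. polygon_diagonals {0..card C - 1}) (sum_rel crossing)
      (free_diagonals S D) crossing"
    using free_diagonals_iso[OF S D(2) \<beta>] free_diagonals_iso[OF S D(1) bij_betw_id] by auto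
  then show ?thesis using rel_iso_comp rel_iso_inv by blast
qed

text \<open>Polygons are glued on one at a time: for a new part \<open>x\<close>, the closing side
  \<open>(0, m)\<close> becomes a diagonal, and beyond it a cell with vertices 0, m, m + 1, ..., m +
  x is attached.\<close>

lemma ex_dissection_cell_partition:
  assumes "N \<noteq> {#}" "\<forall>x\<in>#N. 0 < x"
  shows "\<exists>D\<in>dissections {0..sum_mset N + 1}. cell_partition {0..sum_mset N + 1} D = N"
  using assms
proof (induction N)
  case empty
  then show ?case by simp
next
  case (add x N)
  show ?case
  proof (cases "N = {#}")
    case True
    let ?S = "{0..x + 1}"
    have S: "finite ?S" "3 \<le> card ?S" using add.prems by auto
    have "{} \<in> dissections ?S" by (simp add: dissections_def)
    moreover have "cell_partition ?S {} = {#x#}"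
      unfolding cell_partition_def cells_empty[OF S] using num_sides_eq_card[OF S(2)] by simp
    ultimately show ?thesis using True by auto
  next
    case False
    define m where "m = sum_mset N + 1"
    obtain D' where D': "D' \<in> dissections {0..m}" "cell_partition {0..m} D' = N"
      using add False by (auto simp: m_def)
    obtain y where "y \<in># N" using False by blast
    then have "2 \<le> m" using add.prems by (auto simp: m_def dest!: multi_member_split)
    have "0 < x" using add.prems by simp
    let ?S = "{0..m + x}" and ?S2 = "{0..m + x} - {0<..<m}" and ?D = "insert (0, m) D'"
    have sub: "D' \<subseteq> polygon_diagonals ?S"
      using dissectionsD(1)[OF D'(1)] polygon_diagonals_mono[of "{0..m}" ?S] by auto
    have "(0, m) \<in> polygon_diagonals ?S"
      using \<open>2 \<le> m\<close> \<open>0 < x\<close> by (auto simp: mem_polygon_diagonals_iff intro: bexI[of _ 1] bexI[of _ "m + x"])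
    moreover have "\<not> crossing (0, m) d" "\<not> crossing d (0, m)" if "d \<in> D'" for d
      using dissectionsD(1)[OF D'(1)] that by (cases d; auto simp: crossing_def mem_polygon_diagonals_iff)+
    ultimately have D: "?D \<in> dissections ?S"
      using sub dissectionsD(2)[OF D'(1)] by (auto simp: dissections_def crossing_irrefl)
    have facts: "finite ?S" "?D \<in> dissections ?S" "(0, m) \<in> ?D" using D by auto
    have S1: "?S \<inter> {0..m} = {0..m}" by auto
    have D1: "?D \<inter> polygon_diagonals {0..m} = D'"
      using dissectionsD(1)[OF D'(1)] by (auto simp: mem_polygon_diagonals_iff[of 0])
    \<comment> \<open>All old diagonals lie in the piece \<open>{0..m}\<close>, so the new piece is
      undissected and forms a single cell.\<close>
    have D2: "?D \<inter> polygon_diagonals ?S2 = {}"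
      using split_dissection(2,3)[OF facts] unfolding S1 D1 by blast
    have S2: "finite ?S2" "3 \<le> card ?S2" and "card ?S2 = x + 2"
      using split_card[OF facts] unfolding S1 by auto
    have "cells ?S ?D = cells {0..m} D' \<union> {?S2}" "cells {0..m} D' \<inter> {?S2} = {}"
      using split_cells[OF facts] split_cells_disjoint[OF facts] unfolding S1 D1 D2 cells_empty[OF S2]
      by auto
    then have "cell_partition ?S ?D = add_mset x N"
      using D'(2) num_sides_eq_card[OF S2(2)] \<open>card ?S2 = x + 2\<close> finite_cells[of "{0..m}" D']
      by (simp add: cell_partition_def)
    moreover have "sum_mset (add_mset x N) + 1 = m + x" by (simp add: m_def)
    ultimately show ?thesis using D by metis
  qed
qed

section \<open>Face lattices\<close>

definition nonempty_faces :: "'a::real_vector set \<Rightarrow> 'a set set" where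
  "nonempty_faces P = {F. F face_of P \<and> F \<noteq> {}}"

text \<open>The empty face is the least element of each face lattice and must correspond to itself.
  Dropping it is convenient because dissections represent only nonempty faces.\<close>

lemma comb_equiv_iff_nonempty_faces:
  "comb_equiv P Q \<longleftrightarrow> (\<exists>f. rel_iso f (nonempty_faces P) (\<subseteq>) (nonempty_faces Q) (\<subseteq>))"
proof
  have faces: "{F. F face_of X} = insert {} (nonempty_faces X)" for X :: "'x::euclidean_space set"
    by (auto simp: nonempty_faces_def)
  have empty: "{} \<notin> nonempty_faces X" for X :: "'x::euclidean_space set"
    by (simp add: nonempty_faces_def)
  show "\<exists>f. rel_iso f (nonempty_faces P) (\<subseteq>) (nonempty_faces Q) (\<subseteq>)" if PQ: "comb_equiv P Q"
  proof -
    obtain f where f: "bij_betw f {F. F face_of P} {G. G face_of Q}"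
      and mono: "\<And>F F'. F face_of P \<Longrightarrow> F' face_of P \<Longrightarrow> f F \<subseteq> f F' \<longleftrightarrow> F \<subseteq> F'"
      using PQ by (auto simp: comb_equiv_def)
    obtain G where "G face_of P" "f G = {}"
      using bij_betw_imp_surj_on[OF f] empty_face_of[of Q] by (metis (mono_tags) imageE mem_Collect_eq)
    with mono[of "{}" G] have "f {} = {}" by auto
    then have "bij_betw f (nonempty_faces P) (nonempty_faces Q)"
      using bij_betw_DiffI[OF f, of "{{}}" "{{}}"] empty[of P] empty[of Q] unfolding faces by simp
    with mono have "rel_iso f (nonempty_faces P) (\<subseteq>) (nonempty_faces Q) (\<subseteq>)"
      by (simp add: rel_iso_def nonempty_faces_def)
    then show ?thesis by blast
  qed
  show "comb_equiv P Q" if ex: "\<exists>f. rel_iso f (nonempty_faces P) (\<subseteq>) (nonempty_faces Q) (\<subseteq>)"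
  proof -
    obtain f where f: "bij_betw f (nonempty_faces P) (nonempty_faces Q)"
      and mono: "\<And>F F'. F \<in> nonempty_faces P \<Longrightarrow> F' \<in> nonempty_faces P \<Longrightarrow> f F \<subseteq> f F' \<longleftrightarrow> F \<subseteq> F'"
      using ex by (auto simp: rel_iso_def)
    define g where "g = f({} := {})"
    have g: "g F = f F" if "F \<in> nonempty_faces P" for F
      using that empty[of P] by (auto simp: g_def)
    have "bij_betw g (insert {} (nonempty_faces P)) (insert {} (nonempty_faces Q))"
    proof -
      have "bij_betw g (nonempty_faces P) (nonempty_faces Q)"
        using f g bij_betw_cong by metis
      then show ?thesis
        using bij_betw_combine[of g "{{}}" "{{}}"] empty[of Q] by (simp add: g_def)
    qed
    moreover have "g F \<subseteq> g F' \<longleftrightarrow> F \<subseteq> F'"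
      if "F \<in> insert {} (nonempty_faces P)" "F' \<in> insert {} (nonempty_faces P)" for F F'
    proof (cases "F = {} \<or> F' = {}")
      case True
      moreover have "f F \<noteq> {}" if "F \<in> nonempty_faces P" for F
        using bij_betw_apply[OF f that] empty[of Q] by auto
      ultimately show ?thesis using that by (auto simp: g_def)
    next
      case False
      with that g mono show ?thesis by auto
    qed
    ultimately show ?thesis
      unfolding comb_equiv_def faces[symmetric] by blast
  qed
qed

lemma comb_equiv_refl: "comb_equiv P P"
  unfolding comb_equiv_def by (rule exI[of _ id]) simp

lemma comb_equiv_sym: "comb_equiv P Q \<Longrightarrow> comb_equiv Q P"
  unfolding comb_equiv_iff_nonempty_faces using rel_iso_inv by blast

lemma comb_equiv_trans: "comb_equiv P Q \<Longrightarrow> comb_equiv Q T \<Longrightarrow> comb_equiv P T"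
  unfolding comb_equiv_iff_nonempty_faces using rel_iso_comp by blast

definition independent_sets :: "'v set \<Rightarrow> ('v \<Rightarrow> 'v \<Rightarrow> bool) \<Rightarrow> 'v set set" where
  "independent_sets V R = {N. N \<subseteq> V \<and> (\<forall>x\<in>N. \<forall>y\<in>N. \<not> R x y)}"

text \<open>The polytope is simple, and its polar dual is combinatorially the flag complex of the
  complement of the graph \<open>(V, R)\<close>.\<close>

definition flag_faces :: "'a::real_vector set \<Rightarrow> 'v set \<Rightarrow> ('v \<Rightarrow> 'v \<Rightarrow> bool) \<Rightarrow> bool" where
  "flag_faces P V R \<longleftrightarrow> (\<exists>\<phi>. rel_iso \<phi> (independent_sets V R) (\<supseteq>) (nonempty_faces P) (\<subseteq>))"

lemma rel_iso_independent_sets: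
  assumes g: "rel_iso g V R W Q"
  shows "rel_iso ((`) g) (independent_sets V R) (\<supseteq>) (independent_sets W Q) (\<supseteq>)"
proof -
  have W: "W = g ` V" and inj: "inj_on g V"
    and R: "\<And>x y. x \<in> V \<Longrightarrow> y \<in> V \<Longrightarrow> Q (g x) (g y) \<longleftrightarrow> R x y"
    using g by (auto simp: rel_iso_def bij_betw_def)
  have indep: "g ` N \<in> independent_sets W Q \<longleftrightarrow> N \<in> independent_sets V R" if "N \<subseteq> V" for N
  proof -
    have "(\<forall>x\<in>N. \<forall>y\<in>N. \<not> Q (g x) (g y)) \<longleftrightarrow> (\<forall>x\<in>N. \<forall>y\<in>N. \<not> R x y)"
      using that R by (metis subsetD)
    with that show ?thesis
      unfolding W independent_sets_def by (simp add: image_mono)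
  qed
  have "(`) g ` independent_sets V R = independent_sets W Q"
  proof
    show "(`) g ` independent_sets V R \<subseteq> independent_sets W Q"
      using indep by (auto simp: independent_sets_def[of V])
    show "independent_sets W Q \<subseteq> (`) g ` independent_sets V R"
    proof
      fix M assume M: "M \<in> independent_sets W Q"
      then obtain N where "N \<subseteq> V" "M = g ` N"
        unfolding independent_sets_def W by (auto simp: subset_image_iff)
      with M indep show "M \<in> (`) g ` independent_sets V R" by blast
    qed
  qed
  moreover have "g ` M \<subseteq> g ` N \<longleftrightarrow> M \<subseteq> N" if "M \<subseteq> V" "N \<subseteq> V" for M N
    using inj_on_image_subset_iff[OF inj that] .
  moreover have "inj_on ((`) g) (independent_sets V R)"
    by (rule inj_on_subset[OF inj_on_image_Pow[OF inj]]) (auto simp: independent_sets_def)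
  ultimately show ?thesis
    by (auto simp: rel_iso_def bij_betw_def independent_sets_def[of V])
qed

text \<open>The graph is recovered from the atoms and from which pairs of atoms have an upper bound.\<close>

lemma rel_iso_of_independent_sets:
  assumes f: "rel_iso f (independent_sets V R) (\<supseteq>) (independent_sets W Q) (\<supseteq>)"
    and irrefl: "\<And>x. \<not> R x x" "\<And>x. \<not> Q x x"
    and sym: "\<And>x y. R x y \<Longrightarrow> R y x" "\<And>x y. Q x y \<Longrightarrow> Q y x"
  shows "\<exists>g. rel_iso g V R W Q"
proof -
  let ?A = "independent_sets V R" and ?B = "independent_sets W Q"
  have surj: "f ` ?A = ?B" and inj: "inj_on f ?A"
    and mono: "\<And>M N. M \<in> ?A \<Longrightarrow> N \<in> ?A \<Longrightarrow> f M \<subseteq> f N \<longleftrightarrow> M \<subseteq> N"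
    using f by (auto simp: rel_iso_def bij_betw_def)
  have A: "{} \<in> ?A" "\<And>x. x \<in> V \<Longrightarrow> {x} \<in> ?A" and B: "{} \<in> ?B" "\<And>y. y \<in> W \<Longrightarrow> {y} \<in> ?B"
    using irrefl by (auto simp: independent_sets_def)
  have compat: "\<not> R x y \<longleftrightarrow> (\<exists>N\<in>?A. {x} \<subseteq> N \<and> {y} \<subseteq> N)" if "x \<in> V" "y \<in> V" for x y
    using that irrefl sym by (auto simp: independent_sets_def intro!: exI[of _ "{x, y}"])
  have compat': "\<not> Q x y \<longleftrightarrow> (\<exists>N\<in>?B. {x} \<subseteq> N \<and> {y} \<subseteq> N)" if "x \<in> W" "y \<in> W" for x y
    using that irrefl sym by (auto simp: independent_sets_def intro!: exI[of _ "{x, y}"])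
  obtain N0 where "N0 \<in> ?A" "f N0 = {}" using surj B(1) by (metis imageE)
  with mono[of "{}" N0] A have f0: "f {} = {}" by auto
  \<comment> \<open>For y in \<open>f {x}\<close>, the preimage of \<open>{y}\<close> is a nonempty
    subset of \<open>{x}\<close>, hence \<open>{x}\<close> itself: atoms go to atoms.\<close>
  have atom: "\<exists>y\<in>W. f {x} = {y}" if x: "x \<in> V" for x
  proof -
    have "f {x} \<noteq> {}"
      using inj_onD[OF inj _ A(2)[OF x] A(1)] f0 by auto
    then obtain y where y: "y \<in> f {x}" by blast
    moreover have "f {x} \<in> ?B" using surj A(2)[OF x] by blast
    ultimately have "y \<in> W" by (auto simp: independent_sets_def)
    then obtain N where N: "N \<in> ?A" "f N = {y}" using surj B(2) by (metis imageE)
    then have "N \<subseteq> {x}" using mono[OF N(1) A(2)[OF x]] y by simp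
    moreover have "N \<noteq> {}" using f0 N by auto
    ultimately have "N = {x}" by blast
    with N \<open>y \<in> W\<close> show ?thesis by blast
  qed
  then obtain g where g: "\<And>x. x \<in> V \<Longrightarrow> g x \<in> W" "\<And>x. x \<in> V \<Longrightarrow> f {x} = {g x}"
    by metis
  have "inj_on g V"
    using g(2) inj_onD[OF inj] A(2) by (metis inj_onI singleton_inject)
  moreover have "W \<subseteq> g ` V"
  proof
    fix y assume "y \<in> W"
    then obtain N where N: "N \<in> ?A" "f N = {y}" using surj B(2) by (metis imageE)
    then have "N \<noteq> {}" "N \<subseteq> V" using f0 by (auto simp: independent_sets_def)
    then obtain x where x: "x \<in> N" "x \<in> V" by blast
    then have "{g x} \<subseteq> {y}"
      using mono[OF A(2)[OF x(2)] N(1)] g(2)[OF x(2)] N by simp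
    with x show "y \<in> g ` V" by blast
  qed
  moreover have "R x y \<longleftrightarrow> Q (g x) (g y)" if xy: "x \<in> V" "y \<in> V" for x y
  proof -
    have "(\<exists>N\<in>?A. {x} \<subseteq> N \<and> {y} \<subseteq> N) \<longleftrightarrow> (\<exists>N\<in>?A. f {x} \<subseteq> f N \<and> f {y} \<subseteq> f N)"
      using mono[OF A(2)[OF xy(1)]] mono[OF A(2)[OF xy(2)]] by (intro bex_cong) simp_all
    also have "\<dots> \<longleftrightarrow> (\<exists>N\<in>?B. {g x} \<subseteq> N \<and> {g y} \<subseteq> N)"
      unfolding surj[symmetric] g(2)[OF xy(1)] g(2)[OF xy(2)] by blast
    finally show ?thesis
      using compat[OF xy] compat'[OF g(1)[OF xy(1)] g(1)[OF xy(2)]] by blast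
  qed
  ultimately have "rel_iso g V R W Q"
    using g(1) by (auto simp: rel_iso_def bij_betw_def)
  then show ?thesis by blast
qed

lemma comb_equiv_of_rel_iso:
  assumes "flag_faces P V R" "flag_faces P' W Q" "rel_iso g V R W Q"
  shows "comb_equiv P P'"
proof -
  obtain \<phi> \<psi> where "rel_iso \<phi> (independent_sets V R) (\<supseteq>) (nonempty_faces P) (\<subseteq>)"
    "rel_iso \<psi> (independent_sets W Q) (\<supseteq>) (nonempty_faces P') (\<subseteq>)"
    using assms(1,2) unfolding flag_faces_def by blast
  from rel_iso_comp[OF rel_iso_comp[OF rel_iso_inv[OF this(1)] rel_iso_independent_sets[OF assms(3)]] this(2)]
  show ?thesis unfolding comb_equiv_iff_nonempty_faces by blast
qed

lemma rel_iso_of_comb_equiv: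
  assumes "flag_faces P V R" "flag_faces P' W Q" "comb_equiv P P'"
    and "\<And>x. \<not> R x x" "\<And>x. \<not> Q x x" "\<And>x y. R x y \<Longrightarrow> R y x" "\<And>x y. Q x y \<Longrightarrow> Q y x"
  shows "\<exists>g. rel_iso g V R W Q"
proof -
  obtain \<phi> \<psi> f where "rel_iso \<phi> (independent_sets V R) (\<supseteq>) (nonempty_faces P) (\<subseteq>)"
    "rel_iso \<psi> (independent_sets W Q) (\<supseteq>) (nonempty_faces P') (\<subseteq>)"
    "rel_iso f (nonempty_faces P) (\<subseteq>) (nonempty_faces P') (\<subseteq>)"
    using assms(1-3) unfolding flag_faces_def comb_equiv_iff_nonempty_faces by blast
  from rel_iso_comp[OF rel_iso_comp[OF this(1,3)] rel_iso_inv[OF this(2)]]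
  show ?thesis using rel_iso_of_independent_sets assms(4-7) by blast
qed

section \<open>Faces of products\<close>

text \<open>Exchanging some coordinates of \<open>x\<close> and \<open>y\<close> leaves their
  midpoint unchanged. The midpoint lies in \<open>F\<close>, so the face property puts the two
  exchanged points into \<open>F\<close>. If they coincide, they equal the midpoint.\<close>

lemma face_of_product_mix:
  assumes F: "F face_of product_polytope Q" and x: "x \<in> F" and y: "y \<in> F"
  shows "(\<chi> i. if i \<in> I then y $ i else x $ i) \<in> F" (is "?z \<in> F")
proof -
  let ?z' = "\<chi> i. if i \<in> I then x $ i else y $ i"
  have "x \<in> product_polytope Q" "y \<in> product_polytope Q"
    using face_of_imp_subset[OF F] x y by auto
  then have zs: "?z \<in> product_polytope Q" "?z' \<in> product_polytope Q"
    by (auto simp: product_polytope_def)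
  have "midpoint ?z ?z' = midpoint x y"
    by (auto simp: midpoint_def vec_eq_iff add.commute)
  moreover have "midpoint x y \<in> F"
    using closed_segment_subset[OF x y face_of_imp_convex[OF F]] by auto
  ultimately have mid: "midpoint ?z ?z' \<in> F" by simp
  show ?thesis
  proof (cases "?z = ?z'")
    case True
    with mid show ?thesis by simp
  next
    case False
    then show ?thesis
      using face_ofD[OF F _ zs(1) zs(2) mid] by simp
  qed
qed

text \<open>The factors of a face are its coordinate projections; closure under mixing coordinates
  shows that the face is their full product. Conversely, the face property of a product is checked
  in each coordinate.\<close>

lemma nonempty_faces_product:
  "nonempty_faces (product_polytope Q) = product_polytope ` {G. \<forall>i. G i \<in> nonempty_faces (Q i)}"
proof (intro set_eqI iffI)
  fix F assume "F \<in> nonempty_faces (product_polytope Q)"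
  then have F: "F face_of product_polytope Q" "F \<noteq> {}"
    by (auto simp: nonempty_faces_def)
  define G where "G i = (\<lambda>x. x $ i) ` F" for i
  have sub: "F \<subseteq> product_polytope Q" using face_of_imp_subset[OF F(1)] .
  have "z \<in> F" if "z \<in> product_polytope G" for z
  proof -
    have "\<forall>i. \<exists>p\<in>F. p $ i = z $ i"
    proof
      fix i
      have "z $ i \<in> G i" using that by (simp add: product_polytope_def)
      then show "\<exists>p\<in>F. p $ i = z $ i" by (auto simp: G_def)
    qed
    then obtain p where p: "\<And>i. p i \<in> F" "\<And>i. p i $ i = z $ i" by metis
    \<comment> \<open>The point z is assembled one coordinate at a time, taking coordinate j from
      \<open>p j\<close>; finitely many steps suffice as the index type is finite.\<close>
    have "\<exists>w\<in>F. \<forall>i\<in>I. w $ i = z $ i" if "finite I" for I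
      using that
    proof (induction I)
      case empty
      then show ?case using F(2) by auto
    next
      case (insert j I)
      then obtain w where w: "w \<in> F" "\<forall>i\<in>I. w $ i = z $ i" by blast
      show ?case
        using face_of_product_mix[OF F(1) w(1) p(1)[of j], of "{j}"] w(2) p(2)
        by (intro bexI) auto
    qed
    from this[of UNIV] show ?thesis by (auto simp: vec_eq_iff[symmetric])
  qed
  then have "product_polytope G \<subseteq> F" by blast
  moreover have "F \<subseteq> product_polytope G"
    by (auto simp: product_polytope_def G_def)
  ultimately have "F = product_polytope G" by simp
  moreover have "G i \<in> nonempty_faces (Q i)" for i
  proof -
    have "G i face_of Q i"
      unfolding face_of_def
    proof (intro conjI ballI impI)
      show "G i \<subseteq> Q i"
        using sub by (auto simp: G_def product_polytope_def)
      show "convex (G i)"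
        unfolding G_def using face_of_imp_convex[OF F(1)]
        by (intro convex_linear_image) (auto intro: bounded_linear.linear bounded_linear_vec_nth)
      fix u v w assume uv: "u \<in> Q i" "v \<in> Q i" and "w \<in> G i" and seg: "w \<in> open_segment u v"
      then obtain x where x: "x \<in> F" "x $ i = w" by (auto simp: G_def)
      \<comment> \<open>The segment in factor i is lifted to the product by freezing the other
        coordinates at those of a point of \<open>F\<close> above \<open>w\<close>.\<close>
      define ext where "ext a = (\<chi> j. if j = i then a else x $ j)" for a
      have ext: "ext a \<in> product_polytope Q" if "a \<in> Q i" for a
        using that sub x(1) by (auto simp: ext_def product_polytope_def)
      obtain t where t: "0 < t" "t < 1" "w = (1 - t) *\<^sub>R u + t *\<^sub>R v" "u \<noteq> v"
        using seg by (auto simp: in_segment)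
      have "x = (1 - t) *\<^sub>R ext u + t *\<^sub>R ext v"
        using t x(2) by (auto simp: vec_eq_iff ext_def algebra_simps)
      moreover have "ext u \<noteq> ext v"
        using t(4) by (auto simp: ext_def vec_eq_iff)
      ultimately have "x \<in> open_segment (ext u) (ext v)"
        using t by (auto simp: in_segment)
      then have "ext u \<in> F" "ext v \<in> F"
        using face_ofD[OF F(1) _ ext ext x(1)] uv by blast+
      then have "ext u $ i \<in> G i" "ext v $ i \<in> G i" unfolding G_def by blast+
      then show "u \<in> G i" "v \<in> G i" by (simp_all add: ext_def)
    qed
    then show ?thesis using F(2) by (auto simp: nonempty_faces_def G_def)
  qed
  ultimately show "F \<in> product_polytope ` {G. \<forall>i. G i \<in> nonempty_faces (Q i)}" by blast
next
  fix F assume "F \<in> product_polytope ` {G. \<forall>i. G i \<in> nonempty_faces (Q i)}"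
  then obtain G where F: "F = product_polytope G" and G: "\<And>i. G i face_of Q i" "\<And>i. G i \<noteq> {}"
    by (auto simp: nonempty_faces_def)
  have "F face_of product_polytope Q"
    unfolding face_of_def F
  proof (intro conjI ballI impI)
    show "product_polytope G \<subseteq> product_polytope Q"
      using face_of_imp_subset[OF G(1)] by (auto simp: product_polytope_def)
    show "convex (product_polytope G)"
      using face_of_imp_convex[OF G(1)] by (auto simp: product_polytope_def convex_def)
    fix u v w assume uv: "u \<in> product_polytope Q" "v \<in> product_polytope Q"
      and w: "w \<in> product_polytope G" and "w \<in> open_segment u v"
    then obtain t where t: "0 < t" "t < 1" "w = (1 - t) *\<^sub>R u + t *\<^sub>R v"
      by (auto simp: in_segment)
    have "u $ i \<in> G i \<and> v $ i \<in> G i" for i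
    \<comment> \<open>Where the endpoints agree in coordinate i there is no open segment to use, but
      then \<open>w\<close> has the same coordinate.\<close>
    proof (cases "u $ i = v $ i")
      case True
      then have "w $ i = u $ i" unfolding t(3) by (simp flip: scaleR_left_distrib)
      then show ?thesis using w True by (auto simp: product_polytope_def) metis+
    next
      case False
      then have "w $ i \<in> open_segment (u $ i) (v $ i)"
        using t by (auto simp: in_segment)
      then show ?thesis
        using face_ofD[OF G(1)] uv w by (auto simp: product_polytope_def)
    qed
    then show "u \<in> product_polytope G" "v \<in> product_polytope G"
      by (auto simp: product_polytope_def)
  qed
  moreover have "(\<chi> i. SOME x. x \<in> G i) \<in> F"
    using G(2) by (auto simp: F product_polytope_def some_in_eq)
  ultimately show "F \<in> nonempty_faces (product_polytope Q)"
    by (auto simp: nonempty_faces_def)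
qed

text \<open>With all factors nonempty, a point of one factor can be completed to a point of the
  product.\<close>

lemma product_polytope_subset_iff:
  assumes "\<And>i. G i \<noteq> {}"
  shows "product_polytope G \<subseteq> product_polytope H \<longleftrightarrow> (\<forall>i. G i \<subseteq> H i)"
proof
  assume sub: "product_polytope G \<subseteq> product_polytope H"
  show "\<forall>i. G i \<subseteq> H i"
  proof (intro allI subsetI)
    fix i x assume "x \<in> G i"
    then have "(\<chi> j. if j = i then x else SOME y. y \<in> G j) \<in> product_polytope G"
      using assms by (auto simp: product_polytope_def some_in_eq)
    with sub have "(\<chi> j. if j = i then x else SOME y. y \<in> G j) \<in> product_polytope H" by blast
    then show "x \<in> H i" by (auto simp: product_polytope_def dest: spec[of _ i])
  qed
qed (auto simp: product_polytope_def)

text \<open>An independent set of a disjoint union is a family of independent sets, its slices;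
  these correspond to the factors of a nonempty face of the product.\<close>

lemma flag_faces_product:
  fixes Q :: "'r::finite \<Rightarrow> 'a::euclidean_space set"
  assumes "\<And>i. flag_faces (Q i) (V i) R"
  shows "flag_faces (product_polytope Q) (SIGMA i:UNIV. V i) (sum_rel R)"
proof -
  obtain \<phi> where "\<And>i. rel_iso (\<phi> i) (independent_sets (V i) R) (\<supseteq>) (nonempty_faces (Q i)) (\<subseteq>)"
    using assms unfolding flag_faces_def by metis
  then have bij: "\<And>i. bij_betw (\<phi> i) (independent_sets (V i) R) (nonempty_faces (Q i))"
    and anti: "\<And>i M N. M \<in> independent_sets (V i) R \<Longrightarrow> N \<in> independent_sets (V i) R \<Longrightarrow>
      \<phi> i M \<subseteq> \<phi> i N \<longleftrightarrow> N \<subseteq> M"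
    by (auto simp: rel_iso_def)
  let ?V = "SIGMA i:UNIV. V i"
  define \<psi> where "\<psi> M = product_polytope (\<lambda>i. \<phi> i (M `` {i}))" for M
  have slice: "M `` {i} \<in> independent_sets (V i) R"
    if "M \<in> independent_sets ?V (sum_rel R)" for M i
    using that unfolding independent_sets_def sum_rel_def by fastforce
  have \<phi>: "\<phi> i (M `` {i}) \<in> nonempty_faces (Q i)"
    if "M \<in> independent_sets ?V (sum_rel R)" for M i
    using bij_betw_apply[OF bij slice[OF that]] .
  have mono: "\<psi> M \<subseteq> \<psi> N \<longleftrightarrow> N \<subseteq> M"
    if MN: "M \<in> independent_sets ?V (sum_rel R)" "N \<in> independent_sets ?V (sum_rel R)" for M N
  proof -
    have "\<psi> M \<subseteq> \<psi> N \<longleftrightarrow> (\<forall>i. \<phi> i (M `` {i}) \<subseteq> \<phi> i (N `` {i}))"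
      unfolding \<psi>_def using \<phi>[OF MN(1)]
      by (intro product_polytope_subset_iff) (auto simp: nonempty_faces_def)
    also have "\<dots> \<longleftrightarrow> (\<forall>i. N `` {i} \<subseteq> M `` {i})"
      using anti[OF slice[OF MN(1)] slice[OF MN(2)]] by simp
    also have "\<dots> \<longleftrightarrow> N \<subseteq> M" by auto
    finally show ?thesis .
  qed
  then have "inj_on \<psi> (independent_sets ?V (sum_rel R))"
    by (intro inj_onI) (metis order_refl subset_antisym)
  moreover have "\<psi> ` independent_sets ?V (sum_rel R) = nonempty_faces (product_polytope Q)"
  proof
    show "\<psi> ` independent_sets ?V (sum_rel R) \<subseteq> nonempty_faces (product_polytope Q)"
      using \<phi> unfolding nonempty_faces_product \<psi>_def by blast
    show "nonempty_faces (product_polytope Q) \<subseteq> \<psi> ` independent_sets ?V (sum_rel R)"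
    proof
      fix F assume "F \<in> nonempty_faces (product_polytope Q)"
      then obtain G where G: "F = product_polytope G" "\<And>i. G i \<in> nonempty_faces (Q i)"
        unfolding nonempty_faces_product by blast
      have "\<exists>N\<in>independent_sets (V i) R. \<phi> i N = G i" for i
        using G(2)[of i] bij_betw_imp_surj_on[OF bij[of i]] by (metis imageE)
      then obtain N where N: "\<And>i. N i \<in> independent_sets (V i) R" "\<And>i. \<phi> i (N i) = G i"
        by metis
      let ?M = "SIGMA i:UNIV. N i"
      have "?M `` {i} = N i" for i by auto
      then have "F = \<psi> ?M" by (simp add: \<psi>_def G(1) N(2))
      moreover have "?M \<in> independent_sets ?V (sum_rel R)"
        using N(1) unfolding independent_sets_def sum_rel_def by fastforce
      ultimately show "F \<in> \<psi> ` independent_sets ?V (sum_rel R)" by blast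
    qed
  qed
  ultimately have "rel_iso \<psi> (independent_sets ?V (sum_rel R)) (\<supseteq>) (nonempty_faces (product_polytope Q)) (\<subseteq>)"
    using mono by (simp add: rel_iso_def bij_betw_def)
  then show ?thesis unfolding flag_faces_def by blast
qed

section \<open>Faces of the associahedron\<close>

lemma independent_sets_polygon_diagonals:
  "independent_sets (polygon_diagonals S) crossing = dissections S"
  by (simp add: independent_sets_def dissections_def)

lemma flag_faces_associahedron:
  assumes "associahedron m P"
  shows "flag_faces P (polygon_diagonals {0..m}) crossing"
proof -
  obtain \<Phi> where "represents_faces m P \<Phi>"
    using assms by (auto simp: associahedron_def)
  then have "rel_iso \<Phi> (dissections {0..m}) (\<supseteq>) (nonempty_faces P) (\<subseteq>)"
    by (simp add: represents_faces_def rel_iso_def nonempty_faces_def)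
  then show ?thesis
    unfolding flag_faces_def independent_sets_polygon_diagonals by blast
qed

text \<open>The isomorphism sends \<open>N\<close> to \<Phi> (D \<union> N), with E - D as the
  preimage of \<Phi> E. As \<open>N\<close> is disjoint from \<open>D\<close>, comparing the unions
  amounts to comparing the added sets.\<close>

lemma flag_faces_dissection:
  assumes \<Phi>: "represents_faces n P \<Phi>" and D: "D \<in> dissections {0..n}"
  shows "flag_faces (\<Phi> D) (free_diagonals {0..n} D) crossing"
proof -
  let ?S = "{0..n}" and ?I = "independent_sets (free_diagonals {0..n} D) crossing"
  have bij: "bij_betw \<Phi> (dissections ?S) (nonempty_faces P)"
    and anti: "\<And>D E. D \<in> dissections ?S \<Longrightarrow> E \<in> dissections ?S \<Longrightarrow> \<Phi> D \<subseteq> \<Phi> E \<longleftrightarrow> E \<subseteq> D"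
    using \<Phi> by (auto simp: represents_faces_def nonempty_faces_def)
  have face: "\<Phi> D face_of P"
    using bij_betw_apply[OF bij D] by (simp add: nonempty_faces_def)
  have ext: "D \<union> N \<in> dissections ?S" "D \<inter> N = {}" if "N \<in> ?I" for N
    using that D crossing_sym
    unfolding independent_sets_def free_diagonals_def dissections_def by blast+
  have mono: "\<Phi> (D \<union> M) \<subseteq> \<Phi> (D \<union> N) \<longleftrightarrow> N \<subseteq> M" if "M \<in> ?I" "N \<in> ?I" for M N
    using anti[OF ext(1)[OF that(1)] ext(1)[OF that(2)]] ext(2)[OF that(1)] ext(2)[OF that(2)] by blast
  then have "inj_on (\<lambda>N. \<Phi> (D \<union> N)) ?I"
    by (intro inj_onI) (metis order_refl subset_antisym)
  moreover have "(\<lambda>N. \<Phi> (D \<union> N)) ` ?I = nonempty_faces (\<Phi> D)"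
  proof
    have "\<Phi> (D \<union> N) \<in> nonempty_faces (\<Phi> D)" if "N \<in> ?I" for N
      using bij_betw_apply[OF bij ext(1)[OF that]] anti[OF ext(1)[OF that] D] face_of_face[OF face]
      by (simp add: nonempty_faces_def)
    then show "(\<lambda>N. \<Phi> (D \<union> N)) ` ?I \<subseteq> nonempty_faces (\<Phi> D)" by blast
    show "nonempty_faces (\<Phi> D) \<subseteq> (\<lambda>N. \<Phi> (D \<union> N)) ` ?I"
    proof
      fix F assume F: "F \<in> nonempty_faces (\<Phi> D)"
      then have "F \<in> nonempty_faces P" "F \<subseteq> \<Phi> D"
        using face_of_face[OF face] by (auto simp: nonempty_faces_def)
      then obtain E where E: "E \<in> dissections ?S" "F = \<Phi> E" "D \<subseteq> E"
        using bij_betw_imp_surj_on[OF bij] anti[OF _ D] by (metis imageE)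
      then have "E - D \<in> ?I" "D \<union> (E - D) = E"
        unfolding independent_sets_def free_diagonals_def dissections_def by blast+
      with E show "F \<in> (\<lambda>N. \<Phi> (D \<union> N)) ` ?I" by (metis image_eqI)
    qed
  qed
  ultimately have "rel_iso (\<lambda>N. \<Phi> (D \<union> N)) ?I (\<supseteq>) (nonempty_faces (\<Phi> D)) (\<subseteq>)"
    using mono by (simp add: rel_iso_def bij_betw_def)
  then show ?thesis unfolding flag_faces_def by blast
qed

theorem theorem2p3p2:
  fixes n k :: nat
    and K :: "nat \<Rightarrow> 'a::euclidean_space set"
    and \<Phi> :: "(nat \<times> nat) set \<Rightarrow> 'a set"
  assumes "2 \<le> n" and "k \<le> n - 2"
    and "\<And>m. 2 \<le> m \<Longrightarrow> m \<le> n \<Longrightarrow> associahedron m (K m)"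
    and "represents_faces n (K n) \<Phi>"
  shows "equiv (codim_faces k (K n)) (same_type k (K n)) \<and>
         card (face_types k (K n)) = num_partitions_into (k + 1) (n - 1) \<and>
         (\<exists>\<beta>. bij_betw \<beta> (face_types k (K n)) (partitions_into (k + 1) (n - 1)) \<and>
            (\<forall>D\<in>dissections {0..n}. card D = k \<longrightarrow>
               \<beta> (same_type k (K n) `` {\<Phi> D}) = cell_partition {0..n} D)) \<and>
         (\<forall>D\<in>dissections {0..n}. card D = k \<longrightarrow>
            finite (cells {0..n} D) \<and> card (cells {0..n} D) = k + 1 \<and>
            (\<forall>C :: 'r::finite \<Rightarrow> nat set. bij_betw C UNIV (cells {0..n} D) \<longrightarrow>
               comb_equiv (\<Phi> D) (product_polytope (\<lambda>i. K ((num_sides (C i) - 2) + 1))) \<and>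
               product_polytope (\<lambda>i. K ((num_sides (C i) - 2) + 1)) =
                 product_polytope (\<lambda>i. K (num_sides (C i) - 1))))"
proof -
  let ?S = "{0..n}" and ?A = "codim_faces k (K n)" and ?r = "same_type k (K n)"
  have S: "finite ?S" "3 \<le> card ?S" "card ?S - 2 = n - 1" using assms(1) by auto
  have bij: "bij_betw \<Phi> (dissections ?S) {F. F face_of K n \<and> F \<noteq> {}}"
    and dim: "\<And>D. D \<in> dissections ?S \<Longrightarrow> aff_dim (\<Phi> D) = aff_dim (K n) - int (card D)"
    using assms(4) by (auto simp: represents_faces_def)
  have codim: "?A = \<Phi> ` {D \<in> dissections ?S. card D = k}"
  proof
    show "\<Phi> ` {D \<in> dissections ?S. card D = k} \<subseteq> ?A"
      using bij_betw_apply[OF bij] dim by (auto simp: codim_faces_def)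
    show "?A \<subseteq> \<Phi> ` {D \<in> dissections ?S. card D = k}"
    proof
      fix F assume F: "F \<in> ?A"
      then obtain D where "D \<in> dissections ?S" "F = \<Phi> D"
        using bij_betw_imp_surj_on[OF bij] by (auto simp: codim_faces_def)
      with F dim show "F \<in> \<Phi> ` {D \<in> dissections ?S. card D = k}"
        by (auto simp: codim_faces_def)
    qed
  qed
  have equiv: "equiv ?A ?r"
    using comb_equiv_refl comb_equiv_sym comb_equiv_trans
    by (intro equivI) (auto simp: same_type_def intro!: refl_onI symI transI, blast+)
  have type_iff: "comb_equiv (\<Phi> D) (\<Phi> E) \<longleftrightarrow> cell_partition ?S D = cell_partition ?S E"
    if D: "D \<in> dissections ?S" "card D = k" and E: "E \<in> dissections ?S" "card E = k" for D E
  proof -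
    note flag = flag_faces_dissection[OF assms(4) D(1)] flag_faces_dissection[OF assms(4) E(1)]
    show ?thesis
    proof
      assume "comb_equiv (\<Phi> D) (\<Phi> E)"
      then obtain g where "rel_iso g (free_diagonals ?S D) crossing (free_diagonals ?S E) crossing"
        using rel_iso_of_comb_equiv[OF flag] crossing_irrefl crossing_sym by blast
      then show "cell_partition ?S D = cell_partition ?S E"
        using cell_partition_eq_of_iso[OF S(1,2) D(1) E(1)] D(2) E(2) by simp
    next
      assume "cell_partition ?S D = cell_partition ?S E"
      then show "comb_equiv (\<Phi> D) (\<Phi> E)"
        using iso_of_cell_partition_eq[OF S(1,2) D(1) E(1)] comb_equiv_of_rel_iso[OF flag] by blast
    qed
  qed
  \<comment> \<open>The partition as a function of the face. Faces have the same type iff it takes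
    equal values on them, so it descends to the types.\<close>
  define p where "p F = cell_partition ?S (inv_into (dissections ?S) \<Phi> F)" for F
  have p: "p (\<Phi> D) = cell_partition ?S D" if "D \<in> dissections ?S" for D
    using bij_betw_inv_into_left[OF bij that] by (simp add: p_def)
  have r: "?r = {(F, G). F \<in> ?A \<and> G \<in> ?A \<and> p F = p G}"
    using type_iff p unfolding same_type_def codim by auto
  define \<beta> where "\<beta> X = the_elem (p ` X)" for X
  have \<beta>: "\<beta> (?r `` {F}) = p F" if "F \<in> ?A" for F
  proof -
    have "p ` (?r `` {F}) = {p F}" using that unfolding r by auto
    then show ?thesis by (simp add: \<beta>_def)
  qed
  have image: "p ` ?A = partitions_into (k + 1) (n - 1)"
  proof
    show "p ` ?A \<subseteq> partitions_into (k + 1) (n - 1)"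
      using cell_partition_in_partitions_into[OF S(1,2)] p S(3) unfolding codim by auto
    show "partitions_into (k + 1) (n - 1) \<subseteq> p ` ?A"
    proof
      fix N assume N: "N \<in> partitions_into (k + 1) (n - 1)"
      then have N': "N \<noteq> {#}" "\<forall>x\<in>#N. 0 < x" "sum_mset N + 1 = n" "size N = k + 1"
        using assms(1) by (auto simp: partitions_into_def)
      then obtain D where D: "D \<in> dissections ?S" "cell_partition ?S D = N"
        using ex_dissection_cell_partition[OF N'(1,2)] by auto
      \<comment> \<open>The size of the partition is the number of cells, which exceeds the number
        of diagonals by one.\<close>
      then have "card D = k"
        using cell_partition_in_partitions_into[OF S(1,2) D(1)] N'(4) by (simp add: partitions_into_def)
      with D p[OF D(1)] show "N \<in> p ` ?A" unfolding codim by force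
    qed
  qed
  have "bij_betw \<beta> (?A // ?r) (p ` ?A)"
  proof (intro bij_betw_imageI inj_onI)
    fix X Y assume "X \<in> ?A // ?r" "Y \<in> ?A // ?r" and eq: "\<beta> X = \<beta> Y"
    then obtain F G where FG: "F \<in> ?A" "G \<in> ?A" "X = ?r `` {F}" "Y = ?r `` {G}"
      by (auto elim!: quotientE)
    with eq \<beta> have "(F, G) \<in> ?r" unfolding r by simp
    with FG show "X = Y" using equiv_class_eq[OF equiv] by simp
  next
    show "\<beta> ` (?A // ?r) = p ` ?A"
      using \<beta> by (auto simp: quotient_def image_iff)
  qed
  then have types: "bij_betw \<beta> (face_types k (K n)) (partitions_into (k + 1) (n - 1))"
    unfolding image face_types_def .
  have "\<beta> (?r `` {\<Phi> D}) = cell_partition ?S D" if "D \<in> dissections ?S" "card D = k" for D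
    using \<beta>[of "\<Phi> D"] p[OF that(1)] that unfolding codim by simp
  moreover have "finite (cells ?S D) \<and> card (cells ?S D) = k + 1 \<and>
      (\<forall>C :: 'r \<Rightarrow> nat set. bij_betw C UNIV (cells ?S D) \<longrightarrow>
         comb_equiv (\<Phi> D) (product_polytope (\<lambda>i. K ((num_sides (C i) - 2) + 1))) \<and>
         product_polytope (\<lambda>i. K ((num_sides (C i) - 2) + 1)) =
           product_polytope (\<lambda>i. K (num_sides (C i) - 1)))"
    if D: "D \<in> dissections ?S" "card D = k" for D
  proof (intro conjI allI impI)
    show "finite (cells ?S D)" "card (cells ?S D) = k + 1"
      using finite_cells[OF S(1)] card_cells[OF S(1,2) D(1)] D(2) by simp_all
    fix C :: "'r \<Rightarrow> nat set" assume C: "bij_betw C UNIV (cells ?S D)"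
    have cell: "C i \<in> cells ?S D" for i using bij_betw_apply[OF C] by simp
    have size: "3 \<le> card (C i)" "card (C i) \<le> n + 1" for i
      using card_cell_ge[OF cell] card_mono[OF S(1), of "C i"] cell[of i] by (auto simp: cells_def)
    have index: "(num_sides (C i) - 2) + 1 = card (C i) - 1" "num_sides (C i) - 1 = card (C i) - 1" for i
      using size(1)[of i] num_sides_eq_card[OF size(1)] by simp_all
    show "product_polytope (\<lambda>i. K ((num_sides (C i) - 2) + 1)) =
        product_polytope (\<lambda>i. K (num_sides (C i) - 1))"
      unfolding index ..
    \<comment> \<open>A cell has between 3 and n + 1 vertices, so the index lies in the range 2 to n
      where \<open>K\<close> is known to be an associahedron.\<close>
    have "flag_faces (K (card (C i) - 1)) (polygon_diagonals {0..card (C i) - 1}) crossing" for i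
    proof (rule flag_faces_associahedron[OF assms(3)])
      show "2 \<le> card (C i) - 1" "card (C i) - 1 \<le> n" using size[of i] by simp_all
    qed
    note prod = flag_faces_product[OF this]
    obtain g where "rel_iso g (SIGMA i:UNIV. polygon_diagonals {0..card (C i) - 1}) (sum_rel crossing)
        (free_diagonals ?S D) crossing"
      using free_diagonals_iso[OF S(1,2) D(1) C] by blast
    from comb_equiv_of_rel_iso[OF prod flag_faces_dissection[OF assms(4) D(1)] this]
    show "comb_equiv (\<Phi> D) (product_polytope (\<lambda>i. K ((num_sides (C i) - 2) + 1)))"
      unfolding index by (rule comb_equiv_sym)
  qed
  ultimately show ?thesis
    using equiv types bij_betw_same_card[OF types] unfolding num_partitions_into_def by blast
qed

end
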